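(* Let $n=n_P+n_Q$ and let $\hat f_a$ be the data-driven adaptive classifier defined in the context. There exists a constant $C>0$ not depending on $n_P$ or $n_Q$ such that $$\sup_{(P,Q)\in\Pi}\mathbb{E}\,\mathcal{E}_Q(\hat f_a)\le C\left(\left(\frac{n_P}{\log n}\right)^{\frac{2\beta+d}{2\gamma\beta+d}}+\frac{n_Q}{\log n}\right)^{-\frac{\beta(1+\alpha)}{2\beta+d}} .$$
   Context: **Data.** $d\ge 1$; $P$ and $Q$ are probability distributions of a pair $(X,Y)$ on $[0,1]^d\times\{0,1\}$, with $X$-marginals $P_X,Q_X$. One observes $n_P$ i.i.d. pairs $(X_i^P,Y_i^P)\sim P$ and $n_Q$ i.i.d. pairs $(X_i^Q,Y_i^Q)\sim Q$, all mutually independent ($n_P,n_Q\ge 0$ integers, $n_P+n_Q\ge2$). $\mathbb{E}$ is expectation over all observed data. **Regression functions and risk.** $\eta_P(x)=P(Y=1|X=x)$ for $x\in\mathrm{supp}(P_X)$ and $\tfrac12$ otherwise; $\eta_Q$ is defined likewise from $Q$. The Bayes classifier is $f_Q^*(x)=0$ if $\eta_Q(x)\le \frac12$ and $1$ otherwise. For a classifier $\hat f$ (with values in $\{0,1\}$), $R_Q(\hat f)=\mathbb{P}_{(X,Y)\sim Q}(Y\ne\hat f(X))$ and the excess risk is $\mathcal{E}_Q(\hat f)=R_Q(\hat f)-R_Q(f_Q^* )$. **Parameter space.** Fix $\alpha\ge 0$, $C_\alpha>0$, $0<\beta\le 1$, $C_\beta>0$, $\gamma>0$, $C_\gamma>0$,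 $\mu=(\mu_-,\mu_+)$ with $0<\mu_-<\mu_+$, $c_\mu>0$, $r_\mu>0$, with $\alpha\beta\le d$. $\Pi$ is the set of pairs $(P,Q)$ such that: (i) (relative signal exponent) for all $x\in \mathrm{supp}(P_X)\cup\mathrm{supp}(Q_X)$: $(\eta_P(x)-\frac12)(\eta_Q(x)-\frac12)\ge0$ and $|\eta_P(x)-\frac12|\ge C_\gamma|\eta_Q(x)-\frac12|^\gamma$; (ii) (margin) $Q_X(0<|\eta_Q(X)-\frac12|<t)\le C_\alpha t^\alpha$ for all $t>0$; (iii) (smoothness) $|\eta_Q(x_1)-\eta_Q(x_2)|\le C_\beta\|x_1-x_2\|^\beta$ for all $x_1,x_2\in\mathrm{supp}(Q_X)$ (Euclidean norm); (iv) (common support and strong density) $P_X,Q_X$ are absolutely continuous with respect to Lebesgue measure $\lambda$ on $\mathbb{R}^d$, $\Omega:=\mathrm{supp}(P_X)=\mathrm{supp}(Q_X)$, $\lambda[\Omega\cap B(x,r)]\ge c_\mu\lambda[B(x,r)]$ for all $0<r\le r_\mu$, $x\in\Omega$, and $\mu_-<\frac{dP_X}{d\lambda}(x)<\mu_+$, $\mu_-<\frac{dQ_X}{d\lambda}(x)<\mu_+$ for all $x\in\Omega$. **Adaptive classifier $\hat f_a$.** Let $Y^P_{(i)}(x)$ (resp. $Y^Q_{(i)}(x)$) be the label of the $i$-th nearest covariate to $x$ among the $P$-data (resp. $Q$-data). For a point $x$ and $k=1,\dots,n_P+n_Q$, consider the $k$ nearest covariates to $x$ in the combined set $\{X_1^P,\dots,X_{n_P}^P\}\cup\{X_1^Q,\dots,X_{n_Q}^Q\}$,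 and let $k_P^{(k)}$, $k_Q^{(k)}$ be the numbers of them coming from the $P$-data and the $Q$-data. Put $\hat\eta_P^{(k)}=\frac{1}{k_P^{(k)}}\sum_{i=1}^{k_P^{(k)}}Y^P_{(i)}(x)$ ($=\frac12$ if $k_P^{(k)}=0$) and $\hat\eta_Q^{(k)}=\frac{1}{k_Q^{(k)}}\sum_{i=1}^{k_Q^{(k)}}Y^Q_{(i)}(x)$ ($=\frac12$ if $k_Q^{(k)}=0$). The signal-to-noise ratio index is $$\hat r^{(k)}=k_P^{(k)}(\hat\eta_P^{(k)}-\tfrac12)^2+k_Q^{(k)}(\hat\eta_Q^{(k)}-\tfrac12)^2\quad\text{if }\mathrm{sign}(\hat\eta_P^{(k)}-\tfrac12)=\mathrm{sign}(\hat\eta_Q^{(k)}-\tfrac12),$$ $$\hat r^{(k)}=\max\{k_P^{(k)}(\hat\eta_P^{(k)}-\tfrac12)^2,\ k_Q^{(k)}(\hat\eta_Q^{(k)}-\tfrac12)^2\}\quad\text{otherwise},$$ and the intermediate classifier is $$\hat f^{(k)}(x)=\mathbb{I}\left\{\sqrt{k_P^{(k)}}(\hat\eta_P^{(k)}-\tfrac12)+\sqrt{k_Q^{(k)}}(\hat\eta_Q^{(k)}-\tfrac12)\ge0\right\}.$$ Let $k^*$ be the smallest $k$ with $\hat r^{(k)}>(d+3)\log(n_P+n_Q)$ if such $k$ exists, and otherwise $k^*\in\arg\max_k\hat r^{(k)}$. Then $\hat f_a(x)=\hat f^{(k^* )}(x)$. *)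

theory Defs
  imports "HOL-Probability.Probability"
begin

text \<open>Labels are booleans: the label \<open>1\<close> is \<open>True\<close>, the label \<open>0\<close> is \<open>False\<close>, and \<open>of_bool\<close>
  is the embedding of labels into the reals. The dimension \<open>d\<close> is \<open>CARD('d)\<close>.\<close>

type_synonym 'd point = "(real, 'd) vec"
type_synonym 'd law = "('d point \<times> bool) measure"
type_synonym 'd sample = "nat \<Rightarrow> 'd point \<times> bool"
type_synonym 'd data = "'d sample \<times> 'd sample"

section \<open>Distributions, regression functions and risk\<close>

abbreviation pair_space :: "('d::finite) law" where
  "pair_space \<equiv> borel \<Otimes>\<^sub>M count_space UNIV"

definition cube_law :: "('d::finite) law \<Rightarrow> bool" where
  "cube_law P \<longleftrightarrow> prob_space P \<and> sets P = sets pair_space \<and>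
     (AE z in P. \<forall>i. 0 \<le> fst z $ i \<and> fst z $ i \<le> 1)"

definition marginal :: "('d::finite) law \<Rightarrow> 'd point measure" where
  "marginal P = distr P borel fst"

definition support :: "'a::metric_space measure \<Rightarrow> 'a set" where
  "support M = {x. \<forall>e>0. emeasure M (ball x e) > 0}"

text \<open>\<open>P(Y = 1 | X = x)\<close> is determined by \<open>P\<close> only up to a null set of points \<open>x\<close>, while the
  parameter space below imposes conditions at every point of the support. Hence being a regression
  function of \<open>P\<close> is a predicate, which holds for every version of the conditional probability.\<close>

definition regression_function :: "('d::finite) law \<Rightarrow> ('d point \<Rightarrow> real) \<Rightarrow> bool" where
  "regression_function P \<eta> \<longleftrightarrow>
     \<eta> \<in> borel_measurable borel \<and> (\<forall>x. 0 \<le> \<eta> x \<and> \<eta> x \<le> 1) \<and>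
     (\<forall>A\<in>sets borel. measure P (A \<times> {True}) = (LINT x:A|marginal P. \<eta> x)) \<and>
     (\<forall>x. x \<notin> support (marginal P) \<longrightarrow> \<eta> x = 1/2)"

definition bayes_classifier :: "('d point \<Rightarrow> real) \<Rightarrow> 'd point \<Rightarrow> bool" where
  "bayes_classifier \<eta> x \<longleftrightarrow> \<eta> x > 1/2"

definition risk :: "('d::finite) law \<Rightarrow> ('d point \<Rightarrow> bool) \<Rightarrow> real" where
  "risk Q f = measure Q {z \<in> space Q. snd z \<noteq> f (fst z)}"

text \<open>The risk of the Bayes classifier is the same for all versions \<open>\<eta>\<close> of the regression function.\<close>

definition excess_risk :: "('d::finite) law \<Rightarrow> ('d point \<Rightarrow> real) \<Rightarrow> ('d point \<Rightarrow> bool) \<Rightarrow> real" where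
  "excess_risk Q \<eta> f = risk Q f - risk Q (bayes_classifier \<eta>)"

section \<open>The parameter space\<close>

definition relative_signal_exponent ::
  "real \<Rightarrow> real \<Rightarrow> ('d::finite) law \<Rightarrow> ('d point \<Rightarrow> real) \<Rightarrow> 'd law \<Rightarrow> ('d point \<Rightarrow> real) \<Rightarrow> bool" where
  "relative_signal_exponent \<gamma> C\<^sub>\<gamma> P \<eta>P Q \<eta>Q \<longleftrightarrow>
     (\<forall>x \<in> support (marginal P) \<union> support (marginal Q).
        (\<eta>P x - 1/2) * (\<eta>Q x - 1/2) \<ge> 0 \<and>
        \<bar>\<eta>P x - 1/2\<bar> \<ge> C\<^sub>\<gamma> * \<bar>\<eta>Q x - 1/2\<bar> powr \<gamma>)"

definition margin_condition ::
  "real \<Rightarrow> real \<Rightarrow> ('d::finite) law \<Rightarrow> ('d point \<Rightarrow> real) \<Rightarrow> bool" where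
  "margin_condition \<alpha> C\<^sub>\<alpha> Q \<eta>Q \<longleftrightarrow>
     (\<forall>t>0. measure (marginal Q) {x. 0 < \<bar>\<eta>Q x - 1/2\<bar> \<and> \<bar>\<eta>Q x - 1/2\<bar> < t} \<le> C\<^sub>\<alpha> * t powr \<alpha>)"

definition smoothness ::
  "real \<Rightarrow> real \<Rightarrow> ('d::finite) law \<Rightarrow> ('d point \<Rightarrow> real) \<Rightarrow> bool" where
  "smoothness \<beta> C\<^sub>\<beta> Q \<eta>Q \<longleftrightarrow>
     (\<forall>x\<^sub>1 \<in> support (marginal Q). \<forall>x\<^sub>2 \<in> support (marginal Q).
        \<bar>\<eta>Q x\<^sub>1 - \<eta>Q x\<^sub>2\<bar> \<le> C\<^sub>\<beta> * norm (x\<^sub>1 - x\<^sub>2) powr \<beta>)"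

text \<open>As a density is unique only almost everywhere, a pointwise bound on it is a bound on some
  version of it.\<close>

definition density_between :: "real \<Rightarrow> real \<Rightarrow> ('d::finite) point measure \<Rightarrow> bool" where
  "density_between \<mu>\<^sub>1 \<mu>\<^sub>2 M \<longleftrightarrow> absolutely_continuous lborel M \<and>
     (\<exists>p :: 'd point \<Rightarrow> real. p \<in> borel_measurable borel \<and> (\<forall>x. 0 \<le> p x) \<and>
        M = density lborel (\<lambda>x. ennreal (p x)) \<and>
        (\<forall>x \<in> support M. \<mu>\<^sub>1 < p x \<and> p x < \<mu>\<^sub>2))"

definition strong_density ::
  "real \<Rightarrow> real \<Rightarrow> real \<Rightarrow> real \<Rightarrow> ('d::finite) law \<Rightarrow> 'd law \<Rightarrow> bool" where
  "strong_density \<mu>\<^sub>1 \<mu>\<^sub>2 c\<^sub>\<mu> r\<^sub>\<mu> P Q \<longleftrightarrow>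
     support (marginal P) = support (marginal Q) \<and>
     (\<forall>x \<in> support (marginal Q). \<forall>r. 0 < r \<and> r \<le> r\<^sub>\<mu> \<longrightarrow>
        measure lborel (support (marginal Q) \<inter> ball x r) \<ge> c\<^sub>\<mu> * measure lborel (ball x r)) \<and>
     density_between \<mu>\<^sub>1 \<mu>\<^sub>2 (marginal P) \<and> density_between \<mu>\<^sub>1 \<mu>\<^sub>2 (marginal Q)"

text \<open>A pair \<open>(P, Q)\<close> is listed together with the versions of its regression functions for which the
  pointwise conditions hold.\<close>

definition parameter_space ::
  "real \<Rightarrow> real \<Rightarrow> real \<Rightarrow> real \<Rightarrow> real \<Rightarrow> real \<Rightarrow> real \<Rightarrow> real \<Rightarrow> real \<Rightarrow> real \<Rightarrow>
   (('d::finite) law \<times> 'd law \<times> ('d point \<Rightarrow> real) \<times> ('d point \<Rightarrow> real)) set" where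
  "parameter_space \<alpha> C\<^sub>\<alpha> \<beta> C\<^sub>\<beta> \<gamma> C\<^sub>\<gamma> \<mu>\<^sub>1 \<mu>\<^sub>2 c\<^sub>\<mu> r\<^sub>\<mu> = {(P, Q, \<eta>P, \<eta>Q).
     cube_law P \<and> cube_law Q \<and> regression_function P \<eta>P \<and> regression_function Q \<eta>Q \<and>
     relative_signal_exponent \<gamma> C\<^sub>\<gamma> P \<eta>P Q \<eta>Q \<and>
     margin_condition \<alpha> C\<^sub>\<alpha> Q \<eta>Q \<and>
     smoothness \<beta> C\<^sub>\<beta> Q \<eta>Q \<and>
     strong_density \<mu>\<^sub>1 \<mu>\<^sub>2 c\<^sub>\<mu> r\<^sub>\<mu> P Q}"

section \<open>The data and the adaptive classifier\<close>

definition data_law :: "nat \<Rightarrow> ('d::finite) law \<Rightarrow> nat \<Rightarrow> 'd law \<Rightarrow> 'd data measure" where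
  "data_law nP P nQ Q = (\<Pi>\<^sub>M i\<in>{..<nP}. P) \<Otimes>\<^sub>M (\<Pi>\<^sub>M i\<in>{..<nQ}. Q)"

text \<open>The measurable space of the data, common to all laws \<open>P\<close> and \<open>Q\<close>.\<close>

definition data_space :: "nat \<Rightarrow> nat \<Rightarrow> ('d::finite) data measure" where
  "data_space nP nQ = (\<Pi>\<^sub>M i\<in>{..<nP}. pair_space) \<Otimes>\<^sub>M (\<Pi>\<^sub>M i\<in>{..<nQ}. pair_space)"

text \<open>Sample indices in the order of increasing distance to \<open>x\<close>. As \<open>sort_key\<close> is stable, equal
  distances are ordered by index; for absolutely continuous marginals they have probability zero.
  In the combined sample, \<open>Inl i\<close> and \<open>Inr i\<close> stand for the \<open>i\<close>-th element of the \<open>P\<close>-data and of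
  the \<open>Q\<close>-data.\<close>

definition neighbours :: "nat \<Rightarrow> ('d::finite) sample \<Rightarrow> 'd point \<Rightarrow> nat list" where
  "neighbours n S x = sort_key (\<lambda>i. dist (fst (S i)) x) [0..<n]"

definition neighbours_combined ::
  "nat \<Rightarrow> nat \<Rightarrow> ('d::finite) data \<Rightarrow> 'd point \<Rightarrow> (nat + nat) list" where
  "neighbours_combined nP nQ D x =
     sort_key (case_sum (\<lambda>i. dist (fst (fst D i)) x) (\<lambda>i. dist (fst (snd D i)) x))
       (map Inl [0..<nP] @ map Inr [0..<nQ])"

definition kP :: "nat \<Rightarrow> nat \<Rightarrow> ('d::finite) data \<Rightarrow> 'd point \<Rightarrow> nat \<Rightarrow> nat" where
  "kP nP nQ D x k = length (filter isl (take k (neighbours_combined nP nQ D x)))"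

definition kQ :: "nat \<Rightarrow> nat \<Rightarrow> ('d::finite) data \<Rightarrow> 'd point \<Rightarrow> nat \<Rightarrow> nat" where
  "kQ nP nQ D x k = length (filter (\<lambda>j. \<not> isl j) (take k (neighbours_combined nP nQ D x)))"

definition knn_estimate :: "nat \<Rightarrow> ('d::finite) sample \<Rightarrow> 'd point \<Rightarrow> nat \<Rightarrow> real" where
  "knn_estimate n S x m =
     (if m = 0 then 1/2 else (\<Sum>i<m. of_bool (snd (S (neighbours n S x ! i)))) / real m)"

definition eta_hat_P :: "nat \<Rightarrow> nat \<Rightarrow> ('d::finite) data \<Rightarrow> 'd point \<Rightarrow> nat \<Rightarrow> real" where
  "eta_hat_P nP nQ D x k = knn_estimate nP (fst D) x (kP nP nQ D x k)"

definition eta_hat_Q :: "nat \<Rightarrow> nat \<Rightarrow> ('d::finite) data \<Rightarrow> 'd point \<Rightarrow> nat \<Rightarrow> real" where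
  "eta_hat_Q nP nQ D x k = knn_estimate nQ (snd D) x (kQ nP nQ D x k)"

definition snr_index :: "nat \<Rightarrow> nat \<Rightarrow> ('d::finite) data \<Rightarrow> 'd point \<Rightarrow> nat \<Rightarrow> real" where
  "snr_index nP nQ D x k =
     (let sP = real (kP nP nQ D x k) * (eta_hat_P nP nQ D x k - 1/2)^2;
          sQ = real (kQ nP nQ D x k) * (eta_hat_Q nP nQ D x k - 1/2)^2
      in if sgn (eta_hat_P nP nQ D x k - 1/2) = sgn (eta_hat_Q nP nQ D x k - 1/2)
         then sP + sQ else max sP sQ)"

definition intermediate_classifier ::
  "nat \<Rightarrow> nat \<Rightarrow> ('d::finite) data \<Rightarrow> nat \<Rightarrow> 'd point \<Rightarrow> bool" where
  "intermediate_classifier nP nQ D k x \<longleftrightarrow>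
     sqrt (real (kP nP nQ D x k)) * (eta_hat_P nP nQ D x k - 1/2) +
     sqrt (real (kQ nP nQ D x k)) * (eta_hat_Q nP nQ D x k - 1/2) \<ge> 0"

text \<open>The choice of the maximiser in the second case is left open, so this is a predicate
  on \<open>k\<^sup>*\<close>.\<close>

definition is_k_star :: "nat \<Rightarrow> nat \<Rightarrow> ('d::finite) data \<Rightarrow> 'd point \<Rightarrow> nat \<Rightarrow> bool" where
  "is_k_star nP nQ D x k \<longleftrightarrow>
     (let stops = (\<lambda>j. j \<in> {1..nP + nQ} \<and>
            snr_index nP nQ D x j > (real CARD('d) + 3) * ln (real (nP + nQ)))
      in if \<exists>j. stops j then k = (LEAST j. stops j)
         else is_arg_max (snr_index nP nQ D x) (\<lambda>j. j \<in> {1..nP + nQ}) k)"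

text \<open>A version of the adaptive classifier selects a \<open>k\<^sup>*\<close> for all data and all points. It has to be
  jointly measurable, so that its risk and the expectation of its risk are meaningful.\<close>

definition adaptive_classifier ::
  "nat \<Rightarrow> nat \<Rightarrow> (('d::finite) data \<Rightarrow> 'd point \<Rightarrow> bool) \<Rightarrow> bool" where
  "adaptive_classifier nP nQ f \<longleftrightarrow>
     (\<lambda>(D, x). f D x) \<in> data_space nP nQ \<Otimes>\<^sub>M borel \<rightarrow>\<^sub>M count_space UNIV \<and>
     (\<forall>D \<in> space (data_space nP nQ). \<forall>x. \<exists>k.
        is_k_star nP nQ D x k \<and> f D x = intermediate_classifier nP nQ D k x)"

text \<open>The measurability requirement can be met: choosing the least admissible \<open>k\<^sup>*\<close> gives a
  version of the adaptive classifier.\<close>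

lemma measurable_count_space_restrict:
  assumes "f \<in> M \<rightarrow>\<^sub>M count_space UNIV" and "\<And>w. f w \<in> A"
  shows "f \<in> M \<rightarrow>\<^sub>M count_space A"
  using measurable_restrict_space2[of f M A "count_space UNIV"] assms
  by (simp add: restrict_count_space)

lemma measurable_sort_key:
  fixes key :: "'m \<Rightarrow> 'i::countable \<Rightarrow> real"
  assumes key: "\<And>i. i \<in> set xs \<Longrightarrow> (\<lambda>w. key w i) \<in> borel_measurable M"
  shows "(\<lambda>w. sort_key (key w) xs) \<in> M \<rightarrow>\<^sub>M count_space UNIV"
proof -
  have ins: "(\<lambda>w. insort_key (key w) a ys) \<in> M \<rightarrow>\<^sub>M count_space UNIV"
    if "set (a # ys) \<subseteq> set xs" for a ys
    using that
  proof (induction ys)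
    case (Cons y ys)
    have [measurable]: "(\<lambda>w. key w a) \<in> borel_measurable M" "(\<lambda>w. key w y) \<in> borel_measurable M"
      using Cons.prems key by auto
    have [measurable]: "(\<lambda>w. insort_key (key w) a ys) \<in> M \<rightarrow>\<^sub>M count_space UNIV"
      using Cons by auto
    show ?case by simp
  qed simp
  have "(\<lambda>w. sort_key (key w) ys) \<in> M \<rightarrow>\<^sub>M count_space UNIV" if "set ys \<subseteq> set xs" for ys
    using that
  proof (induction ys)
    case Nil
    show ?case by simp
  next
    case (Cons y ys)
    have IH: "(\<lambda>w. sort_key (key w) ys) \<in> M \<rightarrow>\<^sub>M count_space {zs. set zs \<subseteq> set xs}"
      by (rule measurable_count_space_restrict) (use Cons in auto)
    have "(\<lambda>w. insort_key (key w) y (sort_key (key w) ys)) \<in> M \<rightarrow>\<^sub>M count_space UNIV"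
      by (rule measurable_compose_countable'[where f = "\<lambda>zs w. insort_key (key w) y zs", OF ins IH])
         (use Cons.prems in auto)
    then show ?case by simp
  qed
  then show ?thesis by simp
qed

lemma adaptive_classifier_exists:
  assumes "nP + nQ \<ge> 1"
  shows "\<exists>f :: ('d::finite) data \<Rightarrow> 'd point \<Rightarrow> bool. adaptive_classifier nP nQ f"
proof -
  define M :: "('d data \<times> 'd point) measure" where "M = data_space nP nQ \<Otimes>\<^sub>M borel"
  have MP: "(\<lambda>w. fst (fst w) i) \<in> M \<rightarrow>\<^sub>M pair_space" if "i < nP" for i
  proof -
    have [measurable]: "i \<in> {..<nP}" using that by simp
    show ?thesis unfolding M_def data_space_def by measurable
  qed
  have MQ: "(\<lambda>w. snd (fst w) i) \<in> M \<rightarrow>\<^sub>M pair_space" if "i < nQ" for i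
  proof -
    have [measurable]: "i \<in> {..<nQ}" using that by simp
    show ?thesis unfolding M_def data_space_def by measurable
  qed
  have MX[measurable]: "snd \<in> M \<rightarrow>\<^sub>M borel"
    unfolding M_def by measurable
  have dP: "(\<lambda>w. dist (fst (fst (fst w) i)) (snd w)) \<in> borel_measurable M" if "i < nP" for i
    using measurable_compose[OF MP[OF that] measurable_fst] by measurable
  have dQ: "(\<lambda>w. dist (fst (snd (fst w) i)) (snd w)) \<in> borel_measurable M" if "i < nQ" for i
    using measurable_compose[OF MQ[OF that] measurable_fst] by measurable
  have nbP: "(\<lambda>w. neighbours nP (fst (fst w)) (snd w)) \<in> M \<rightarrow>\<^sub>M count_space UNIV"
    unfolding neighbours_def by (rule measurable_sort_key) (use dP in auto)
  have nbQ: "(\<lambda>w. neighbours nQ (snd (fst w)) (snd w)) \<in> M \<rightarrow>\<^sub>M count_space UNIV"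
    unfolding neighbours_def by (rule measurable_sort_key) (use dQ in auto)
  have nbC[measurable]: "(\<lambda>w. neighbours_combined nP nQ (fst w) (snd w)) \<in> M \<rightarrow>\<^sub>M count_space UNIV"
    unfolding neighbours_combined_def by (rule measurable_sort_key) (use dP dQ in auto)
  have kP[measurable]: "(\<lambda>w. kP nP nQ (fst w) (snd w) k) \<in> M \<rightarrow>\<^sub>M count_space UNIV" for k
    unfolding kP_def by measurable
  have kQ[measurable]: "(\<lambda>w. kQ nP nQ (fst w) (snd w) k) \<in> M \<rightarrow>\<^sub>M count_space UNIV" for k
    unfolding kQ_def by measurable
  have kP_le: "kP nP nQ D x k \<le> nP" for D :: "'d data" and x k
  proof -
    have "length (filter isl (take k xs)) \<le> length (filter isl xs)" for xs :: "(nat + nat) list"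
      by (metis append_take_drop_id filter_append length_append le_add1)
    moreover have "length (filter isl (neighbours_combined nP nQ D x)) = nP"
      unfolding neighbours_combined_def
      by (simp add: filter_sort filter_map o_def)
    ultimately show ?thesis unfolding kP_def by metis
  qed
  have kQ_le: "kQ nP nQ D x k \<le> nQ" for D :: "'d data" and x k
  proof -
    have "length (filter (\<lambda>j. \<not> isl j) (take k xs)) \<le> length (filter (\<lambda>j. \<not> isl j) xs)"
      for xs :: "(nat + nat) list"
      by (metis append_take_drop_id filter_append length_append le_add1)
    moreover have "length (filter (\<lambda>j. \<not> isl j) (neighbours_combined nP nQ D x)) = nQ"
      unfolding neighbours_combined_def
      by (simp add: filter_sort filter_map o_def)
    ultimately show ?thesis unfolding kQ_def by metis
  qed
  have nb_lt: "neighbours n S x ! i < n" if "i < n" for n i and S :: "'d sample" and x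
    using nth_mem[of i "neighbours n S x"] that unfolding neighbours_def by simp
  have labP: "(\<lambda>w. of_bool (snd (fst (fst w) (neighbours nP (fst (fst w)) (snd w) ! i))) :: real)
      \<in> borel_measurable M" if i: "i < nP" for i
  proof (rule measurable_compose_countable'[where I = "{..<nP}" and
        f = "\<lambda>j w. of_bool (snd (fst (fst w) j))" and g = "\<lambda>w. neighbours nP (fst (fst w)) (snd w) ! i"])
    show "(\<lambda>w. of_bool (snd (fst (fst w) j)) :: real) \<in> borel_measurable M" if "j \<in> {..<nP}" for j
    proof -
      have [measurable]: "(\<lambda>w. snd (fst (fst w) j)) \<in> M \<rightarrow>\<^sub>M count_space UNIV"
        by (rule measurable_compose[OF MP measurable_snd]) (use that in simp)
      show ?thesis by measurable
    qed
    have "(\<lambda>w. neighbours nP (fst (fst w)) (snd w) ! i) \<in> M \<rightarrow>\<^sub>M count_space UNIV"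
      using nbP by measurable
    then show "(\<lambda>w. neighbours nP (fst (fst w)) (snd w) ! i) \<in> M \<rightarrow>\<^sub>M count_space {..<nP}"
      by (rule measurable_count_space_restrict) (use nb_lt i in auto)
  qed simp
  have labQ: "(\<lambda>w. of_bool (snd (snd (fst w) (neighbours nQ (snd (fst w)) (snd w) ! i))) :: real)
      \<in> borel_measurable M" if i: "i < nQ" for i
  proof (rule measurable_compose_countable'[where I = "{..<nQ}" and
        f = "\<lambda>j w. of_bool (snd (snd (fst w) j))" and g = "\<lambda>w. neighbours nQ (snd (fst w)) (snd w) ! i"])
    show "(\<lambda>w. of_bool (snd (snd (fst w) j)) :: real) \<in> borel_measurable M" if "j \<in> {..<nQ}" for j
    proof -
      have [measurable]: "(\<lambda>w. snd (snd (fst w) j)) \<in> M \<rightarrow>\<^sub>M count_space UNIV"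
        by (rule measurable_compose[OF MQ measurable_snd]) (use that in simp)
      show ?thesis by measurable
    qed
    have "(\<lambda>w. neighbours nQ (snd (fst w)) (snd w) ! i) \<in> M \<rightarrow>\<^sub>M count_space UNIV"
      using nbQ by measurable
    then show "(\<lambda>w. neighbours nQ (snd (fst w)) (snd w) ! i) \<in> M \<rightarrow>\<^sub>M count_space {..<nQ}"
      by (rule measurable_count_space_restrict) (use nb_lt i in auto)
  qed simp
  have eP[measurable]: "(\<lambda>w. eta_hat_P nP nQ (fst w) (snd w) k) \<in> borel_measurable M" for k
    unfolding eta_hat_P_def
  proof (rule measurable_compose_countable'[where I = "{..nP}" and
        f = "\<lambda>m w. knn_estimate nP (fst (fst w)) (snd w) m" and g = "\<lambda>w. kP nP nQ (fst w) (snd w) k"])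
    show "(\<lambda>w. knn_estimate nP (fst (fst w)) (snd w) m) \<in> borel_measurable M" if "m \<in> {..nP}" for m
      unfolding knn_estimate_def using that
      by (cases "m = 0")
         (simp, simp only: if_False, intro borel_measurable_divide borel_measurable_sum labP, auto)
    show "(\<lambda>w. kP nP nQ (fst w) (snd w) k) \<in> M \<rightarrow>\<^sub>M count_space {..nP}"
      by (rule measurable_count_space_restrict) (use kP kP_le in auto)
  qed simp
  have eQ[measurable]: "(\<lambda>w. eta_hat_Q nP nQ (fst w) (snd w) k) \<in> borel_measurable M" for k
    unfolding eta_hat_Q_def
  proof (rule measurable_compose_countable'[where I = "{..nQ}" and
        f = "\<lambda>m w. knn_estimate nQ (snd (fst w)) (snd w) m" and g = "\<lambda>w. kQ nP nQ (fst w) (snd w) k"])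
    show "(\<lambda>w. knn_estimate nQ (snd (fst w)) (snd w) m) \<in> borel_measurable M" if "m \<in> {..nQ}" for m
      unfolding knn_estimate_def using that
      by (cases "m = 0")
         (simp, simp only: if_False, intro borel_measurable_divide borel_measurable_sum labQ, auto)
    show "(\<lambda>w. kQ nP nQ (fst w) (snd w) k) \<in> M \<rightarrow>\<^sub>M count_space {..nQ}"
      by (rule measurable_count_space_restrict) (use kQ kQ_le in auto)
  qed simp
  have kPr[measurable]: "(\<lambda>w. real (kP nP nQ (fst w) (snd w) k)) \<in> borel_measurable M" for k
    by measurable
  have kQr[measurable]: "(\<lambda>w. real (kQ nP nQ (fst w) (snd w) k)) \<in> borel_measurable M" for k
    by measurable
  have snr[measurable]: "(\<lambda>w. snr_index nP nQ (fst w) (snd w) k) \<in> borel_measurable M" for k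
    unfolding snr_index_def Let_def
    by (intro measurable_If borel_measurable_add borel_measurable_max borel_measurable_times
          borel_measurable_power borel_measurable_diff borel_measurable_const borel_measurable_eq
          measurable_compose[OF _ borel_measurable_sgn] eP eQ kPr kQr)
  have le_pred: "Measurable.pred M (\<lambda>w. g w \<le> h w)"
    if [measurable]: "g \<in> borel_measurable M" "h \<in> borel_measurable M" for g h :: "_ \<Rightarrow> real"
    by measurable
  have sqrt_meas: "(\<lambda>w. sqrt (g w)) \<in> borel_measurable M"
    if [measurable]: "g \<in> borel_measurable M" for g
    by measurable
  have ic[measurable]: "Measurable.pred M (\<lambda>w. intermediate_classifier nP nQ (fst w) k (snd w))" for k
    unfolding intermediate_classifier_def
    by (rule le_pred) (intro borel_measurable_add borel_measurable_times borel_measurable_diff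
      borel_measurable_const sqrt_meas eP eQ kPr kQr)+
  have star_gen: "Measurable.pred M (\<lambda>w. if \<exists>j. j \<in> I \<and> r w j > c
      then k = (LEAST j. j \<in> I \<and> r w j > c) else is_arg_max (r w) (\<lambda>j. j \<in> I) k)"
    if [measurable]: "\<And>j. (\<lambda>w. r w j) \<in> borel_measurable M"
    for r :: "_ \<Rightarrow> nat \<Rightarrow> real" and c k and I :: "nat set"
    unfolding is_arg_max_def by measurable
  have star[measurable]: "Measurable.pred M (\<lambda>w. is_k_star nP nQ (fst w) (snd w) k)" for k
    unfolding is_k_star_def Let_def by (rule star_gen) (rule snr)
  have ex: "\<exists>k. is_k_star nP nQ D x k" for D :: "'d data" and x
  proof -
    define I where "I = {1..nP + nQ}"
    have I: "finite (snr_index nP nQ D x ` I)" "snr_index nP nQ D x ` I \<noteq> {}"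
      using assms unfolding I_def by auto
    obtain k where k: "k \<in> I" "snr_index nP nQ D x k = Max (snr_index nP nQ D x ` I)"
      using Max_in[OF I] by (metis imageE)
    have "is_arg_max (snr_index nP nQ D x) (\<lambda>j. j \<in> I) k"
      unfolding is_arg_max_linorder using k Max_ge[OF I(1)] by auto
    then show ?thesis unfolding is_k_star_def Let_def I_def by metis
  qed
  define f :: "'d data \<Rightarrow> 'd point \<Rightarrow> bool" where
    "f D x = intermediate_classifier nP nQ D (LEAST k. is_k_star nP nQ D x k) x" for D x
  have "(\<lambda>w. f (fst w) (snd w)) \<in> M \<rightarrow>\<^sub>M count_space UNIV"
    unfolding f_def
    by (rule measurable_compose_countable[where f = "\<lambda>k w. intermediate_classifier nP nQ (fst w) k (snd w)"])
       (intro ic measurable_Least star)+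
  then have "adaptive_classifier nP nQ f"
    unfolding adaptive_classifier_def M_def f_def case_prod_beta
    using LeastI_ex[OF ex] by blast
  then show ?thesis by blast
qed

end

theory Submission
  imports Defs
begin

text \<open>Fix a point \<open>x\<close> of the support and let \<open>z = \<bar>\<eta>Q x - 1/2\<bar>\<close>. A wrong decision at \<open>x\<close> costs \<open>2 * z\<close>, and by
  Fubini's theorem the expected excess risk is the \<open>Q\<close>-integral of this cost times the probability of
  a wrong decision at \<open>x\<close>. So it is enough to bound that probability for one point at a time.

  In a ball of radius proportional to \<open>z powr (1 / \<beta>)\<close>, smoothness and the relative signal exponent
  bound all regression values away from \<open>1/2\<close>, on the same side as at \<open>x\<close> (\<open>local_signal\<close>). Given the
  covariates, the labels are independent, so for every number of neighbours within the ball the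
  averaged labels deviate to the wrong side by little, with probability \<open>1 - O(1/n\<^sup>2)\<close>
  (\<open>nearest_labels_deviation\<close>). On this event a signal-to-noise index above the threshold can only
  belong to a correct decision (\<open>signal_to_noise_decides\<close>), as long as the neighbours stay in the ball.
  And if the ball contains enough points of at least one sample, the index crosses the threshold
  before the neighbours leave the ball. The procedure thus stops in time without knowing the
  ball, the smoothness, or which sample is the better one (\<open>adaptive_choice_correct\<close>).

  The ball does contain enough points once \<open>z\<close> exceeds a multiple of the distance \<open>\<Delta>\<close> at which
  signal and noise balance in the better of the two samples (\<open>signal_above_rate\<close>). Points closer to
  the decision boundary than this contribute at most \<open>2 * \<Delta>\<close> times their mass, which is
  \<open>O(\<Delta> powr \<alpha>)\<close> by the margin condition. This gives the bound \<open>O(\<Delta> powr (1 + \<alpha>))\<close>, the rate of the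
  theorem; the failure probability \<open>O(1/n\<^sup>2)\<close> at all other points is of no larger order
  (\<open>inverse_square_le_rate\<close>).\<close>

section \<open>Nearest neighbours in a ball\<close>

definition ball_count :: "nat \<Rightarrow> ('d::finite) sample \<Rightarrow> 'd point \<Rightarrow> real \<Rightarrow> nat" where
  "ball_count n S x r = length (filter (\<lambda>i. dist (fst (S i)) x < r) [0..<n])"

text \<open>The points of a sample inside a ball around \<open>x\<close> are a prefix of the list of its points sorted by the
  distance to \<open>x\<close>. Every statement below on nearest neighbours comes from this fact.\<close>

lemma take_sort_key_below:
  fixes key :: "'a \<Rightarrow> 'b::linorder"
  shows "take (length (filter (\<lambda>i. key i < c) xs)) (sort_key key xs)
    = sort_key key (filter (\<lambda>i. key i < c) xs)"
proof -
  have eq: "filter (\<lambda>i. key i < c) ys = takeWhile (\<lambda>i. key i < c) ys" if "sorted (map key ys)" for ys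
    using that
  proof (induction ys)
    case (Cons y ys)
    then have "filter (\<lambda>i. key i < c) ys = []" if "\<not> key y < c"
      unfolding filter_empty_conv using Cons.prems that by (auto dest: order.strict_trans1)
    with Cons show ?case by auto
  qed simp
  have "length (filter (\<lambda>i. key i < c) xs) = length (filter (\<lambda>i. key i < c) (sort_key key xs))"
    by (simp add: filter_sort)
  then show ?thesis
    by (metis eq filter_sort sorted_sort_key takeWhile_eq_take)
qed

lemma neighbours_in_ball:
  assumes "j < ball_count n S x r"
  shows "dist (fst (S (neighbours n S x ! j))) x < r"
proof -
  define L where "L = sort_key (\<lambda>i. dist (fst (S i)) x) (filter (\<lambda>i. dist (fst (S i)) x < r) [0..<n])"
  have "take (ball_count n S x r) (neighbours n S x) = L"
    unfolding ball_count_def neighbours_def L_def by (rule take_sort_key_below)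
  then have "neighbours n S x ! j = L ! j"
    using assms by (metis nth_take)
  moreover have "L ! j \<in> set L"
    using assms by (intro nth_mem) (simp add: L_def ball_count_def)
  ultimately show ?thesis
    by (simp add: L_def)
qed

text \<open>As long as \<open>k\<close> does not exceed the number of points in the ball, the \<open>k\<close> nearest points of the
  combined sample use only labels from inside the ball, and at the last such \<open>k\<close> they use all of them.\<close>

lemma combined_ball_counts:
  fixes D :: "('d::finite) data" and x :: "'d point" and r :: real and nP nQ :: nat
  defines "NP \<equiv> ball_count nP (fst D) x r" and "NQ \<equiv> ball_count nQ (snd D) x r"
  shows "kP nP nQ D x (NP + NQ) = NP" "kQ nP nQ D x (NP + NQ) = NQ"
    and "k \<le> NP + NQ \<Longrightarrow> kP nP nQ D x k \<le> NP" "k \<le> NP + NQ \<Longrightarrow> kQ nP nQ D x k \<le> NQ"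
proof -
  define key where "key = case_sum (\<lambda>i. dist (fst (fst D i)) x) (\<lambda>i. dist (fst (snd D i)) x)"
  define xs where "xs = map Inl [0..<nP] @ map Inr [0..<nQ]"
  let ?in = "filter (\<lambda>i. key i < r) xs"
  have comb: "neighbours_combined nP nQ D x = sort_key key xs"
    unfolding neighbours_combined_def key_def xs_def ..
  have "length ?in = NP + NQ"
    unfolding xs_def NP_def NQ_def ball_count_def key_def by (simp add: filter_map o_def)
  then have take_all: "take (NP + NQ) (neighbours_combined nP nQ D x) = sort_key key ?in"
    using take_sort_key_below[of key r xs] comb by simp
  have isl: "length (filter isl (sort_key key ?in)) = NP"
    unfolding xs_def NP_def ball_count_def key_def by (simp add: filter_map o_def filter_sort)
  have not_isl: "length (filter (\<lambda>j. \<not> isl j) (sort_key key ?in)) = NQ"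
    unfolding xs_def NQ_def ball_count_def key_def by (simp add: filter_map o_def filter_sort)
  show all: "kP nP nQ D x (NP + NQ) = NP" "kQ nP nQ D x (NP + NQ) = NQ"
    using isl not_isl take_all by (simp_all add: kP_def kQ_def)
  have mono: "length (filter p (take k ys)) \<le> length (filter p (take l ys))"
    if "k \<le> l" for p k l and ys :: "(nat + nat) list"
    by (metis append_take_drop_id filter_append length_append le_add1 min.absorb1 take_take that)
  show "k \<le> NP + NQ \<Longrightarrow> kP nP nQ D x k \<le> NP" "k \<le> NP + NQ \<Longrightarrow> kQ nP nQ D x k \<le> NQ"
    using mono all unfolding kP_def kQ_def by metis+
qed

section \<open>The stopping rule\<close>

text \<open>Let \<open>a\<close> and \<open>b\<close> be the normalised deviations of the two samples from \<open>1/2\<close>, and \<open>\<sigma>\<close> the sign of the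
  correct class. Noise can push each of them at most \<open>t\<close> to the wrong side. If both were on the wrong
  side, the index \<open>a\<^sup>2 + b\<^sup>2\<close> would not exceed \<open>2 * t\<^sup>2\<close>. If they disagree, the index is the larger
  square, so the larger deviation is more than \<open>t\<close>; hence it is on the correct side and outweighs the
  other one. This is why a large index certifies the sign of the sum, without knowledge of the signal.\<close>

lemma signal_to_noise_decides:
  fixes a b t \<sigma> :: real
  assumes "\<sigma> = 1 \<or> \<sigma> = -1" and "t > 0"
    and a: "\<sigma> * a \<ge> - t" and b: "\<sigma> * b \<ge> - t"
    and large: "(if sgn a = sgn b then a\<^sup>2 + b\<^sup>2 else max (a\<^sup>2) (b\<^sup>2)) > 2 * t\<^sup>2"
  shows "\<sigma> * (a + b) > 0"
proof (rule ccontr)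
  define u v where "u = \<sigma> * a" and "v = \<sigma> * b"
  assume "\<not> \<sigma> * (a + b) > 0"
  then have sum: "u + v \<le> 0"
    by (simp add: u_def v_def algebra_simps)
  have sq: "u\<^sup>2 = a\<^sup>2" "v\<^sup>2 = b\<^sup>2"
    using assms(1) by (auto simp: u_def v_def)
  have bound: "-t \<le> u" "u \<le> t" "-t \<le> v" "v \<le> t"
    using a b sum by (auto simp: u_def v_def)
  then have "u\<^sup>2 \<le> t\<^sup>2" "v\<^sup>2 \<le> t\<^sup>2"
    using \<open>t > 0\<close> by (simp_all add: abs_le_square_iff[symmetric] abs_le_iff)
  then show False
    using large zero_less_power[OF \<open>t > 0\<close>, of 2] sq by (smt (verit))
qed

text \<open>The index and the intermediate classifier depend on the data only through the same two normalised
  deviations.\<close>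

lemma snr_index_conv:
  "snr_index nP nQ D x k =
     (let a = sqrt (real (kP nP nQ D x k)) * (eta_hat_P nP nQ D x k - 1/2);
          b = sqrt (real (kQ nP nQ D x k)) * (eta_hat_Q nP nQ D x k - 1/2)
      in if sgn a = sgn b then a\<^sup>2 + b\<^sup>2 else max (a\<^sup>2) (b\<^sup>2))"
proof -
  have P: "sgn (sqrt (real (kP nP nQ D x k)) * (eta_hat_P nP nQ D x k - 1/2))
      = sgn (eta_hat_P nP nQ D x k - 1/2)"
    by (cases "kP nP nQ D x k = 0") (auto simp: eta_hat_P_def knn_estimate_def sgn_mult)
  have Q: "sgn (sqrt (real (kQ nP nQ D x k)) * (eta_hat_Q nP nQ D x k - 1/2))
      = sgn (eta_hat_Q nP nQ D x k - 1/2)"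
    by (cases "kQ nP nQ D x k = 0") (auto simp: eta_hat_Q_def knn_estimate_def sgn_mult)
  show ?thesis
    unfolding snr_index_def Let_def P Q by (simp add: power_mult_distrib)
qed

text \<open>The sign \<open>\<sigma>\<close> stands for the correct class, so that both classes are treated at once; \<open>s\<close> is a lower
  bound for the signal of the labels and \<open>t\<close> the fluctuation that is allowed, in units of the
  standard deviation of a mean.\<close>

definition concentrated ::
  "real \<Rightarrow> real \<Rightarrow> real \<Rightarrow> nat \<Rightarrow> ('d::finite) sample \<Rightarrow> 'd point \<Rightarrow> nat \<Rightarrow> bool" where
  "concentrated \<sigma> s t n S x N \<longleftrightarrow>
     (\<forall>m\<in>{1..N}. \<sigma> * (sqrt (real m) * (knn_estimate n S x m - 1/2)) \<ge> sqrt (real m) * s - t)"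

text \<open>The deterministic core of the proof. Every index that crosses the threshold inside the ball
  certifies a correct decision, and at the last \<open>k\<close> of the ball the index does cross it. Hence the
  first crossing takes place inside the ball and the decision made there is correct. The factor \<open>3\<close>
  exceeds \<open>1 + sqrt 2\<close>: after a loss of \<open>t\<close> to noise, a deviation above \<open>sqrt 2 * t\<close> has to remain.\<close>

lemma adaptive_choice_correct:
  fixes D :: "('d::finite) data" and x :: "'d point" and r :: real and nP nQ :: nat
  defines "NP \<equiv> ball_count nP (fst D) x r" and "NQ \<equiv> ball_count nQ (snd D) x r"
  assumes \<sigma>: "\<sigma> = 1 \<or> \<sigma> = -1" and t: "t > 0"
    and T: "2 * t\<^sup>2 = (real CARD('d) + 3) * ln (real (nP + nQ))"
    and s: "sP \<ge> 0" "sQ \<ge> 0"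
    and P: "concentrated \<sigma> sP t nP (fst D) x NP"
    and Q: "concentrated \<sigma> sQ t nQ (snd D) x NQ"
    and enough: "sqrt (real NP) * sP \<ge> 3 * t \<or> sqrt (real NQ) * sQ \<ge> 3 * t"
    and star: "is_k_star nP nQ D x k"
  shows "\<sigma> * (sqrt (real (kP nP nQ D x k)) * (eta_hat_P nP nQ D x k - 1/2) +
              sqrt (real (kQ nP nQ D x k)) * (eta_hat_Q nP nQ D x k - 1/2)) > 0"
proof -
  let ?a = "\<lambda>k. sqrt (real (kP nP nQ D x k)) * (eta_hat_P nP nQ D x k - 1/2)"
  let ?b = "\<lambda>k. sqrt (real (kQ nP nQ D x k)) * (eta_hat_Q nP nQ D x k - 1/2)"
  let ?T = "(real CARD('d) + 3) * ln (real (nP + nQ))"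
  let ?stops = "\<lambda>j. j \<in> {1..nP + nQ} \<and> snr_index nP nQ D x j > ?T"
  note counts = combined_ball_counts[where nP = nP and nQ = nQ and D = D and x = x and r = r, folded NP_def NQ_def]
  have a: "\<sigma> * ?a k \<ge> sqrt (real (kP nP nQ D x k)) * sP - t" if "k \<le> NP + NQ" for k
    using P counts(3)[OF that] t
    by (cases "kP nP nQ D x k = 0") (auto simp: concentrated_def eta_hat_P_def)
  have b: "\<sigma> * ?b k \<ge> sqrt (real (kQ nP nQ D x k)) * sQ - t" if "k \<le> NP + NQ" for k
    using Q counts(4)[OF that] t
    by (cases "kQ nP nQ D x k = 0") (auto simp: concentrated_def eta_hat_Q_def)
  have snr: "(if sgn (?a k) = sgn (?b k) then (?a k)\<^sup>2 + (?b k)\<^sup>2 else max ((?a k)\<^sup>2) ((?b k)\<^sup>2))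
      = snr_index nP nQ D x k" for k
    by (simp add: snr_index_conv Let_def)
  have sq: "2 * t\<^sup>2 < c\<^sup>2" if "\<sigma> * c \<ge> 2 * t" for c
  proof -
    have "(2 * t)\<^sup>2 \<le> (\<sigma> * c)\<^sup>2"
      using that t by (intro power_mono) auto
    also have "(\<sigma> * c)\<^sup>2 = c\<^sup>2" using \<sigma> by auto
    finally show ?thesis using t by (simp add: power_mult_distrib)
       (smt (verit) zero_less_power)
  qed
  \<comment> \<open>At the last \<open>k\<close> within the ball the whole signal of the ball is collected.\<close>
  have "2 * t\<^sup>2 < (?a (NP + NQ))\<^sup>2 \<or> 2 * t\<^sup>2 < (?b (NP + NQ))\<^sup>2"
    using enough a[of "NP + NQ"] b[of "NP + NQ"] sq counts(1,2) by (smt (verit) order_refl)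
  then have stop: "snr_index nP nQ D x (NP + NQ) > ?T"
    unfolding snr[symmetric] T[symmetric] by (smt (verit) zero_le_power2)
  have "NP + NQ \<noteq> 0"
    using enough t by (auto intro!: Nat.gr0I)
  moreover have "NP \<le> nP" "NQ \<le> nQ"
    unfolding NP_def NQ_def ball_count_def by (metis length_filter_le length_upt minus_nat.diff_0)+
  ultimately have stops: "?stops (NP + NQ)"
    using stop by (simp add: Suc_le_eq)
  then have k: "k = (LEAST j. ?stops j)"
    using star unfolding is_k_star_def Let_def by (metis (no_types, lifting))
  have "k \<le> NP + NQ"
    unfolding k by (rule Least_le) (rule stops)
  moreover have "snr_index nP nQ D x k > ?T"
    using LeastI[of ?stops, OF stops] unfolding k by blast
  ultimately have le: "k \<le> NP + NQ" and snr_k: "snr_index nP nQ D x k > 2 * t\<^sup>2"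
    by (simp_all only: T)
  have ge: "- t \<le> c" if "sqrt (real m) * s' - t \<le> c" "s' \<ge> 0" for c s' and m :: nat
    using that mult_nonneg_nonneg[of "sqrt (real m)" s'] by (simp del: mult_nonneg_nonneg)
  show ?thesis
    by (rule signal_to_noise_decides[OF \<sigma> t])
       (use ge[OF a[OF le] s(1)] ge[OF b[OF le] s(2)] snr_k snr[of k] in simp_all)
qed

section \<open>Support and conditional law of the labels\<close>

text \<open>The points outside the support have null neighbourhoods, and countably many of these cover the
  complement by Lindelof's theorem. So the conditions of the parameter space, which are imposed on the
  support only, hold at almost every observed point.\<close>

lemma AE_in_support:
  fixes M :: "'a::{metric_space, second_countable_topology} measure"
  assumes "sets M = sets borel"
  shows "AE x in M. x \<in> support M"
proof -
  define F where "F = {ball x e | x e. e > 0 \<and> emeasure M (ball x e) = 0}"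
  obtain F' where F': "F' \<subseteq> F" "countable F'" "\<Union>F' = \<Union>F"
    by (rule Lindelof[of F]) (auto simp: F_def)
  have "(\<Union>U\<in>F'. U) \<in> null_sets M"
    by (rule null_sets_UN') (use F' assms in \<open>auto simp: F_def null_sets_def\<close>)
  moreover have "{x \<in> space M. x \<notin> support M} \<subseteq> (\<Union>U\<in>F'. U)"
    using F'(3) by (force simp: support_def F_def not_less)
  ultimately show ?thesis
    by (rule AE_I')
qed

lemma closed_support: "closed (support M)" if "sets M = sets borel" for M :: "'a::metric_space measure"
  unfolding closed_def open_contains_ball
proof
  fix x assume "x \<in> - support M"
  then obtain e where e: "e > 0" "emeasure M (ball x e) = 0"
    by (auto simp: support_def not_less)
  have "ball x (e/2) \<subseteq> - support M"
  proof
    fix y assume y: "y \<in> ball x (e/2)"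
    have "ball y (e/2) \<subseteq> ball x e"
    proof (rule subsetI)
      fix z assume "z \<in> ball y (e/2)"
      then show "z \<in> ball x e"
        using y dist_triangle[of x z y] by simp
    qed
    then have "emeasure M (ball y (e/2)) = 0"
      using emeasure_mono[of "ball y (e/2)" "ball x e" M] that e by simp
    then show "y \<in> - support M"
      using e by (auto simp: support_def intro!: exI[of _ "e/2"])
  qed
  then show "\<exists>e>0. ball x e \<subseteq> - support M"
    using e by (intro exI[of _ "e/2"]) auto
qed

lemma sets_marginal: "sets (marginal P) = sets borel"
  by (simp add: marginal_def)

context
  fixes P :: "('d::finite) law"
  assumes cube: "cube_law P"
begin

interpretation P: prob_space P
  using cube by (simp add: cube_law_def)

lemma cube_law_sets [measurable_cong]: "sets P = sets pair_space"
  using cube by (simp add: cube_law_def)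

lemma cube_law_space: "space P = UNIV"
  using sets_eq_imp_space_eq[OF cube_law_sets] by (simp add: space_pair_measure)

lemma prob_space_marginal: "prob_space (marginal P)"
  unfolding marginal_def by (rule P.prob_space_distr) measurable

context
  fixes \<eta> assumes reg: "regression_function P \<eta>"
begin

lemma regression_measurable [measurable]: "\<eta> \<in> borel_measurable borel"
  and regression_ge_0: "0 \<le> \<eta> x" and regression_le_1: "\<eta> x \<le> 1"
  using reg by (auto simp: regression_function_def)

lemma emeasure_label_True:
  assumes A [measurable]: "A \<in> sets borel"
  shows "emeasure P (A \<times> {True}) = (\<integral>\<^sup>+x. ennreal (\<eta> x) * indicator A x \<partial>marginal P)"
proof -
  interpret X: prob_space "marginal P" by (rule prob_space_marginal)
  note [measurable_cong] = sets_marginal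
  have int: "integrable (marginal P) (\<lambda>x. indicator A x *\<^sub>R \<eta> x)"
    by (rule X.integrable_const_bound[of _ 1])
       (auto simp: indicator_def regression_ge_0 regression_le_1)
  have "emeasure P (A \<times> {True}) = ennreal (LINT x:A|marginal P. \<eta> x)"
    using reg A by (simp add: P.emeasure_eq_measure regression_function_def)
  also have "\<dots> = (\<integral>\<^sup>+x. ennreal (indicator A x *\<^sub>R \<eta> x) \<partial>marginal P)"
    unfolding set_lebesgue_integral_def
    by (rule nn_integral_eq_integral[OF int, symmetric]) (auto simp: regression_ge_0)
  also have "\<dots> = (\<integral>\<^sup>+x. ennreal (\<eta> x) * indicator A x \<partial>marginal P)"
    by (intro nn_integral_cong) (simp add: indicator_def)
  finally show ?thesis .
qed

lemma emeasure_label_False: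
  assumes A [measurable]: "A \<in> sets borel"
  shows "emeasure P (A \<times> {False}) = (\<integral>\<^sup>+x. ennreal (1 - \<eta> x) * indicator A x \<partial>marginal P)"
proof -
  note [measurable_cong] = sets_marginal
  have "emeasure P (A \<times> {False}) + emeasure P (A \<times> {True}) = emeasure P (A \<times> UNIV)"
    by (subst plus_emeasure) (auto intro!: arg_cong[where f = "emeasure P"])
  also have "\<dots> = emeasure (marginal P) A"
    unfolding marginal_def
    by (subst emeasure_distr) (auto intro!: arg_cong[where f = "emeasure P"] simp: cube_law_space)
  also have "\<dots> = (\<integral>\<^sup>+x. ennreal (1 - \<eta> x) * indicator A x + ennreal (\<eta> x) * indicator A x \<partial>marginal P)"
    by (subst nn_integral_indicator[symmetric])
       (auto simp: sets_marginal ennreal_plus[symmetric] regression_ge_0 regression_le_1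
          distrib_right[symmetric] simp del: ennreal_plus intro!: nn_integral_cong)
  also have "\<dots> = (\<integral>\<^sup>+x. ennreal (1 - \<eta> x) * indicator A x \<partial>marginal P)
      + emeasure P (A \<times> {True})"
    by (subst nn_integral_add) (auto simp: emeasure_label_True)
  finally show ?thesis
    by (simp add: P.emeasure_eq_measure)
qed

text \<open>Disintegration: the regression function was introduced by the mass of the sets \<open>A \<times> {True}\<close>; here it
  becomes the conditional law of the label given the covariate.\<close>

lemma nn_integral_law:
  assumes [measurable]: "G \<in> borel_measurable pair_space"
  shows "(\<integral>\<^sup>+z. G z \<partial>P)
    = (\<integral>\<^sup>+x. ennreal (\<eta> x) * G (x, True) + ennreal (1 - \<eta> x) * G (x, False) \<partial>marginal P)"
proof -
  note [measurable_cong] = sets_marginal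
  define w where "w b x = ennreal (if b then \<eta> x else 1 - \<eta> x)" for b x
  have [measurable]: "w b \<in> borel_measurable borel" for b
    unfolding w_def by (cases b) simp_all
  have Gb: "(\<lambda>x. G (x, b)) \<in> borel_measurable borel" for b
    by measurable
  have fst_P: "fst \<in> P \<rightarrow>\<^sub>M borel"
    by measurable
  have Gb_P: "(\<lambda>z. G (fst z, b)) \<in> borel_measurable P" for b
    by (rule measurable_compose[OF fst_P Gb])
  have ind: "(\<lambda>z. indicator {b} (snd z) :: ennreal) \<in> borel_measurable P" for b
    using measurable_compose[OF measurable_snd, of "indicator {b} :: bool \<Rightarrow> ennreal" "count_space UNIV" borel borel]
    by (simp add: measurable_cong_sets[OF cube_law_sets refl])
  have label: "distr (density P (\<lambda>z. indicator {b} (snd z))) borel fst = density (marginal P) (w b)" for b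
  proof (rule measure_eqI)
    fix A assume "A \<in> sets (distr (density P (\<lambda>z. indicator {b} (snd z))) borel fst)"
    then have [measurable]: "A \<in> sets borel" by simp
    have "fst -` A \<inter> space P \<in> sets P"
      by measurable
    then have [simp]: "fst -` A \<in> sets P"
      by (simp add: cube_law_space)
    have "emeasure (distr (density P (\<lambda>z. indicator {b} (snd z))) borel fst) A
        = (\<integral>\<^sup>+z. indicator {b} (snd z) * indicator (fst -` A) z \<partial>P)"
      by (subst emeasure_distr, measurable)
         (subst emeasure_density, auto simp: cube_law_space ind)
    also have "\<dots> = (\<integral>\<^sup>+z. indicator (A \<times> {b}) z \<partial>P)"
      by (intro nn_integral_cong) (auto simp: indicator_def)
    also have "\<dots> = emeasure P (A \<times> {b})"
      by (rule nn_integral_indicator) measurable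
    also have "\<dots> = emeasure (density (marginal P) (w b)) A"
      by (cases b) (simp_all add: emeasure_density emeasure_label_True emeasure_label_False
          w_def sets_marginal)
    finally show "emeasure (distr (density P (\<lambda>z. indicator {b} (snd z))) borel fst) A
        = emeasure (density (marginal P) (w b)) A" .
  qed (simp add: sets_marginal)
  have part: "(\<integral>\<^sup>+z. indicator {b} (snd z) * G (fst z, b) \<partial>P) = (\<integral>\<^sup>+x. w b x * G (x, b) \<partial>marginal P)" for b
  proof -
    have "(\<integral>\<^sup>+z. indicator {b} (snd z) * G (fst z, b) \<partial>P)
        = (\<integral>\<^sup>+x. G (x, b) \<partial>distr (density P (\<lambda>z. indicator {b} (snd z))) borel fst)"
      using fst_P Gb Gb_P ind by (simp add: nn_integral_distr nn_integral_density)
    also have "\<dots> = (\<integral>\<^sup>+x. w b x * G (x, b) \<partial>marginal P)"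
      unfolding label using Gb
      by (subst nn_integral_density) (simp_all add: measurable_cong_sets[OF sets_marginal refl])
    finally show ?thesis .
  qed
  have "(\<integral>\<^sup>+z. G z \<partial>P) = (\<integral>\<^sup>+z. indicator {True} (snd z) * G (fst z, True)
      + indicator {False} (snd z) * G (fst z, False) \<partial>P)"
    by (intro nn_integral_cong) (auto simp: indicator_def split: prod.splits)
  also have "\<dots> = (\<integral>\<^sup>+x. w True x * G (x, True) \<partial>marginal P) + (\<integral>\<^sup>+x. w False x * G (x, False) \<partial>marginal P)"
    by (subst nn_integral_add) (auto intro!: borel_measurable_times_ennreal ind Gb_P simp: part)
  also have "\<dots> = (\<integral>\<^sup>+x. w True x * G (x, True) + w False x * G (x, False) \<partial>marginal P)"
    using Gb by (intro nn_integral_add[symmetric]) (auto simp: measurable_cong_sets[OF sets_marginal refl])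
  finally show ?thesis
    by (simp add: w_def)
qed

text \<open>Integration of a single label in a sample. The function \<open>G\<close> does not see the label of the point \<open>i\<close>,
  so that label may be averaged first, with all covariates and all other labels fixed. This replaces
  the statement that the labels are independent given the covariates.\<close>

lemma integrate_out_label:
  fixes g :: "bool \<Rightarrow> real"
  defines "M \<equiv> \<lambda>I :: nat set. \<Pi>\<^sub>M i\<in>I. P"
  assumes I: "finite I" "i \<in> I" and G [measurable]: "G \<in> borel_measurable (M I)"
    and label_free: "\<And>S b. G (S(i := (fst (S i), b))) = G S"
    and local: "\<And>S. G S \<noteq> 0 \<Longrightarrow> fst (S i) \<in> B"
    and g: "\<And>b. 0 \<le> g b" and c: "0 \<le> c"
    and mean: "AE x in marginal P. x \<in> B \<longrightarrow> \<eta> x * g True + (1 - \<eta> x) * g False \<le> c"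
  shows "(\<integral>\<^sup>+S. G S * ennreal (g (snd (S i))) \<partial>M I) \<le> ennreal c * (\<integral>\<^sup>+S. G S \<partial>M I)"
proof -
  interpret product_sigma_finite "\<lambda>_::nat. P" by standard
  define J where "J = I - {i}"
  have J: "finite J" "i \<notin> J" "I = insert i J"
    using I by (auto simp: J_def)
  have [measurable]: "i \<in> I" by fact
  have [measurable]: "G \<in> borel_measurable (M (insert i J))"
    using G J by simp
  have upd [measurable]: "(\<lambda>y. G (S(i := y))) \<in> borel_measurable P" if "S \<in> space (M J)" for S
    by (rule measurable_compose[OF measurable_fun_upd[OF _ measurable_const[OF that[unfolded M_def]]]])
       (use G J in \<open>auto simp: M_def\<close>)
  have inner: "(\<integral>\<^sup>+y. G (S(i := y)) * ennreal (g (snd y)) \<partial>P) \<le> ennreal c * (\<integral>\<^sup>+y. G (S(i := y)) \<partial>P)"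
    if S: "S \<in> space (M J)" for S
  proof -
    note [measurable] = upd[OF S]
    have m [measurable]: "(\<lambda>y. G (S(i := y))) \<in> borel_measurable pair_space"
      using upd[OF S] by (simp cong: measurable_cong_sets add: cube_law_sets)
    have Gm: "(\<lambda>x. G (S(i := (x, True)))) \<in> borel_measurable borel"
      by (rule measurable_compose[OF _ m]) measurable
    have eq: "G (S(i := (x, False))) = G (S(i := (x, True)))" for x
      using label_free[of "S(i := (x, True))" False] by simp
    have "(\<integral>\<^sup>+y. G (S(i := y)) * ennreal (g (snd y)) \<partial>P)
       = (\<integral>\<^sup>+x. G (S(i := (x, True))) * ennreal (\<eta> x * g True + (1 - \<eta> x) * g False) \<partial>marginal P)"
      by (subst nn_integral_law, measurable, intro nn_integral_cong)
         (simp add: eq regression_ge_0 regression_le_1 g ennreal_plus ennreal_mult distrib_left mult_ac)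
    also have "\<dots> \<le> (\<integral>\<^sup>+x. ennreal c * G (S(i := (x, True))) \<partial>marginal P)"
    proof (rule nn_integral_mono_AE)
      show "AE x in marginal P. G (S(i := (x, True))) * ennreal (\<eta> x * g True + (1 - \<eta> x) * g False)
          \<le> ennreal c * G (S(i := (x, True)))"
        using mean
      proof eventually_elim
        case (elim x)
        show ?case
        proof (cases "G (S(i := (x, True))) = 0")
          case False
          then have "\<eta> x * g True + (1 - \<eta> x) * g False \<le> c"
            using local[of "S(i := (x, True))"] elim by simp
          then show ?thesis
            by (subst mult.commute) (intro mult_right_mono ennreal_leI, auto)
        qed simp
      qed
    qed
    also have "\<dots> = ennreal c * (\<integral>\<^sup>+x. G (S(i := (x, True))) \<partial>marginal P)"
      by (rule nn_integral_cmult) (simp add: measurable_cong_sets[OF sets_marginal refl] Gm)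
    also have "(\<integral>\<^sup>+x. G (S(i := (x, True))) \<partial>marginal P) = (\<integral>\<^sup>+y. G (S(i := y)) \<partial>P)"
      by (subst nn_integral_law[OF m], subst eq, intro nn_integral_cong)
         (simp add: distrib_right[symmetric] ennreal_plus[symmetric] regression_ge_0 regression_le_1
            del: ennreal_plus)
    finally show ?thesis .
  qed
  have "(\<integral>\<^sup>+S. G S * ennreal (g (snd (S i))) \<partial>M I)
      = (\<integral>\<^sup>+S. \<integral>\<^sup>+y. G (S(i := y)) * ennreal (g (snd y)) \<partial>P \<partial>M J)"
    unfolding M_def J(3) using G unfolding M_def J(3)
    by (subst product_nn_integral_insert[OF J(1,2)]) (simp_all add: J)
  also have "\<dots> \<le> (\<integral>\<^sup>+S. ennreal c * (\<integral>\<^sup>+y. G (S(i := y)) \<partial>P) \<partial>M J)"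
    by (intro nn_integral_mono inner)
  also have "\<dots> = ennreal c * (\<integral>\<^sup>+S. G S \<partial>M I)"
    unfolding M_def J(3) using G unfolding M_def J(3)
    by (subst product_nn_integral_insert[OF J(1,2)]) (simp_all add: nn_integral_cmult)
  finally show ?thesis .
qed

end
end

section \<open>Concentration of the labels of the nearest neighbours\<close>

lemma measurable_sample:
  fixes P :: "('d::finite) law"
  assumes cube: "cube_law P" and "i \<in> I"
  shows "(\<lambda>S. fst (S i)) \<in> (\<Pi>\<^sub>M i\<in>I. P) \<rightarrow>\<^sub>M borel"
    and "(\<lambda>S. snd (S i)) \<in> (\<Pi>\<^sub>M i\<in>I. P) \<rightarrow>\<^sub>M count_space UNIV"
proof -
  have comp: "(\<lambda>S. S i) \<in> (\<Pi>\<^sub>M i\<in>I. P) \<rightarrow>\<^sub>M pair_space"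
    using measurable_component_singleton[of i I "\<lambda>_. P"] assms(2)
    by (simp add: measurable_cong_sets[OF refl cube_law_sets[OF cube]])
  show "(\<lambda>S. fst (S i)) \<in> (\<Pi>\<^sub>M i\<in>I. P) \<rightarrow>\<^sub>M borel"
    and "(\<lambda>S. snd (S i)) \<in> (\<Pi>\<^sub>M i\<in>I. P) \<rightarrow>\<^sub>M count_space UNIV"
    using measurable_compose[OF comp measurable_fst] measurable_compose[OF comp measurable_snd]
    by simp_all
qed

lemma measurable_sample_dist:
  fixes P :: "('d::finite) law"
  assumes cube: "cube_law P" and "i \<in> I"
  shows "(\<lambda>S. dist (fst (S i)) x) \<in> borel_measurable (\<Pi>\<^sub>M i\<in>I. P)"
  by (rule measurable_compose[OF measurable_sample(1)[OF assms]]) measurable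

text \<open>The labels of the points in \<open>A\<close> are integrated out one by one. The function \<open>F\<close> will be the indicator of
  the event that \<open>A\<close> is the set of the nearest neighbours: it is determined by the covariates, which
  is why the random choice of \<open>A\<close> does not disturb the independence of the labels.\<close>

lemma label_mgf:
  fixes P :: "('d::finite) law" and g :: "bool \<Rightarrow> real" and I :: "nat set"
  assumes cube: "cube_law P" and reg: "regression_function P \<eta>"
    and I: "finite I" "A \<subseteq> I" and F [measurable]: "F \<in> borel_measurable (\<Pi>\<^sub>M i\<in>I. P)"
    and label_free: "\<And>S S'. (\<And>i. fst (S i) = fst (S' i)) \<Longrightarrow> F S = F S'"
    and local: "\<And>S i. F S \<noteq> 0 \<Longrightarrow> i \<in> A \<Longrightarrow> fst (S i) \<in> B"
    and g: "\<And>b. 0 \<le> g b" and c: "0 \<le> c"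
    and mean: "AE x in marginal P. x \<in> B \<longrightarrow> \<eta> x * g True + (1 - \<eta> x) * g False \<le> c"
  shows "(\<integral>\<^sup>+S. F S * (\<Prod>i\<in>A. ennreal (g (snd (S i)))) \<partial>(\<Pi>\<^sub>M i\<in>I. P))
    \<le> ennreal c ^ card A * (\<integral>\<^sup>+S. F S \<partial>(\<Pi>\<^sub>M i\<in>I. P))"
proof -
  have "finite A" by (rule finite_subset[OF I(2,1)])
  have lab: "(\<lambda>S. ennreal (g (snd (S i)))) \<in> borel_measurable (\<Pi>\<^sub>M i\<in>I. P)" if "i \<in> I" for i
    by (rule measurable_compose[OF measurable_sample(2)[OF cube that]]) simp
  show ?thesis
    using \<open>finite A\<close> \<open>A \<subseteq> I\<close> local
  proof (induction A)
    case (insert a A)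
    let ?G = "\<lambda>S. F S * (\<Prod>i\<in>A. ennreal (g (snd (S i))))"
    have [measurable]: "?G \<in> borel_measurable (\<Pi>\<^sub>M i\<in>I. P)"
      using insert.prems lab by (intro borel_measurable_times_ennreal F borel_measurable_prod_ennreal) auto
    have "(\<integral>\<^sup>+S. F S * (\<Prod>i\<in>insert a A. ennreal (g (snd (S i)))) \<partial>(\<Pi>\<^sub>M i\<in>I. P))
        = (\<integral>\<^sup>+S. ?G S * ennreal (g (snd (S a))) \<partial>(\<Pi>\<^sub>M i\<in>I. P))"
      using insert.hyps by (intro nn_integral_cong) (simp add: mult_ac)
    also have "\<dots> \<le> ennreal c * (\<integral>\<^sup>+S. ?G S \<partial>(\<Pi>\<^sub>M i\<in>I. P))"
    proof (rule integrate_out_label[OF cube reg \<open>finite I\<close> _ _ _ _ g c mean])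
      show "?G (S(a := (fst (S a), b))) = ?G S" for S b
        using insert.hyps
        by (intro arg_cong2[where f = "(*)"] label_free prod.cong) auto
      show "?G S \<noteq> 0 \<Longrightarrow> fst (S a) \<in> B" for S
        using insert.prems by auto
    qed (use insert.prems in auto)
    also have "\<dots> \<le> ennreal c * (ennreal c ^ card A * (\<integral>\<^sup>+S. F S \<partial>(\<Pi>\<^sub>M i\<in>I. P)))"
      using insert.prems by (intro mult_left_mono insert.IH) auto
    finally show ?case
      using insert.hyps by (simp add: mult_ac)
  qed simp
qed

text \<open>Hoeffding's lemma for a label whose probability of being correct is at least \<open>1/2 + s\<close>.\<close>

lemma signed_label_mgf:
  fixes \<sigma> s \<theta> y :: real
  assumes \<sigma>: "\<sigma> = 1 \<or> \<sigma> = -1" and "0 \<le> \<theta>" "0 \<le> y" "y \<le> 1" and s: "\<sigma> * (y - 1/2) \<ge> s"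
  shows "y * exp (- \<theta> * (\<sigma> * (of_bool True - 1/2))) + (1 - y) * exp (- \<theta> * (\<sigma> * (of_bool False - 1/2)))
    \<le> exp (\<theta>\<^sup>2 / 8 - \<theta> * s)"
proof -
  define q where "q = 1/2 - \<sigma> * (y - 1/2)"
  have q: "0 \<le> q" "q \<le> 1" "q - 1/2 \<le> - s"
    using assms by (auto simp: q_def)
  have pos: "1 + q * (exp \<theta> - 1) > 0"
    using q \<open>0 \<le> \<theta>\<close> by (intro add_pos_nonneg) auto
  have "y * exp (- \<theta> * (\<sigma> * (of_bool True - 1/2))) + (1 - y) * exp (- \<theta> * (\<sigma> * (of_bool False - 1/2)))
      = (1 - q) * exp (- \<theta> / 2) + q * exp (\<theta> / 2)"
    using \<sigma> by (auto simp: q_def field_simps)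
  also have "\<dots> = exp (- \<theta> / 2) * (1 + q * (exp \<theta> - 1))"
    by (simp add: algebra_simps exp_add[symmetric])
  also have "1 + q * (exp \<theta> - 1) = exp (ln (1 + q * (exp \<theta> - 1)))"
    using pos by simp
  also have "\<dots> \<le> exp (\<theta>\<^sup>2 / 8 + \<theta> * q)"
    using Hoeffdings_lemma_aux[OF \<open>0 \<le> \<theta>\<close> q(1)] by simp
  also have "exp (- \<theta> / 2) * exp (\<theta>\<^sup>2 / 8 + \<theta> * q) = exp (\<theta>\<^sup>2 / 8 + \<theta> * (q - 1/2))"
    by (simp add: exp_add[symmetric] algebra_simps)
  also have "\<dots> \<le> exp (\<theta>\<^sup>2 / 8 - \<theta> * s)"
    using mult_left_mono[OF q(3) \<open>0 \<le> \<theta>\<close>] by simp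
  finally show ?thesis by simp
qed

lemma measurable_neighbours:
  fixes P :: "('d::finite) law"
  assumes cube: "cube_law P"
  shows "(\<lambda>S. neighbours n S x) \<in> (\<Pi>\<^sub>M i\<in>{..<n}. P) \<rightarrow>\<^sub>M count_space UNIV"
  unfolding neighbours_def by (rule measurable_sort_key) (auto intro!: measurable_sample_dist[OF cube])

text \<open>Hoeffding's inequality for the first \<open>m\<close> neighbours. The event is split according to the set \<open>A\<close> of these
  neighbours. On each part the Chernoff bound costs the factor \<open>exp (- 2 * t\<^sup>2)\<close> and leaves the
  probability of the part; as the parts are disjoint, these probabilities add up to at most \<open>1\<close>. So
  there is no union bound over the sets \<open>A\<close>.\<close>

lemma nearest_labels_deviation:
  fixes P :: "('d::finite) law" and x :: "'d point"
  defines "M \<equiv> \<lambda>n::nat. \<Pi>\<^sub>M i\<in>{..<n}. P"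
  assumes cube: "cube_law P" and reg: "regression_function P \<eta>"
    and \<sigma>: "\<sigma> = 1 \<or> \<sigma> = -1" and t: "t > 0" and m: "m \<ge> 1"
    and signal: "AE y in marginal P. y \<in> ball x r \<longrightarrow> \<sigma> * (\<eta> y - 1/2) \<ge> s"
  shows "\<exists>E\<in>sets (M n). emeasure (M n) E \<le> ennreal (exp (- 2 * t\<^sup>2)) \<and>
    {S \<in> space (M n). m \<le> ball_count n S x r \<and>
        \<sigma> * (sqrt (real m) * (knn_estimate n S x m - 1/2)) < sqrt (real m) * s - t} \<subseteq> E"
proof -
  interpret P: prob_space P using cube by (simp add: cube_law_def)
  interpret PM: prob_space "M n" unfolding M_def by (rule prob_space_PiM) (rule P.prob_space_axioms)
  define nearest where "nearest S = set (take m (neighbours n S x))" for S :: "'d sample"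
  define dev where "dev S A = (\<Sum>i\<in>A. \<sigma> * (of_bool (snd (S i)) - 1/2))" for S :: "'d sample" and A
  \<comment> \<open>Membership in the sample space is kept out of \<open>C\<close>: it constrains the values outside the
    index set, so that \<open>F\<close> is not a function of the covariates alone.\<close>
  define C where "C A = {S :: 'd sample. nearest S = A \<and> (\<forall>i\<in>A. dist x (fst (S i)) < r)}" for A
  define F where "F A = {S \<in> space (M n). S \<in> C A}" for A
  define E where "E A = {S \<in> F A. dev S A \<le> m * s - sqrt m * t}" for A
  define As where "As = {A. A \<subseteq> {..<n} \<and> card A = m}"
  \<comment> \<open>the Chernoff parameter that minimises \<open>m * \<theta>\<^sup>2 / 8 - \<theta> * sqrt m * t\<close>\<close>
  define \<theta> where "\<theta> = 4 * t / sqrt m"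
  define g where "g b = exp (- \<theta> * (\<sigma> * (of_bool b - 1/2)))" for b
  have "\<theta> > 0"
    using t m by (simp add: \<theta>_def)
  have "finite As"
    by (simp add: As_def)
  have Y: "(\<lambda>S. snd (S i)) \<in> M n \<rightarrow>\<^sub>M count_space UNIV"
    and D: "(\<lambda>S. dist (fst (S i)) x) \<in> borel_measurable (M n)" if "i < n" for i
    unfolding M_def using that
    by (auto intro!: measurable_sample(2)[OF cube] measurable_sample_dist[OF cube])
  have nb [measurable]: "(\<lambda>S. neighbours n S x) \<in> M n \<rightarrow>\<^sub>M count_space UNIV"
    unfolding M_def by (rule measurable_neighbours[OF cube])
  have F_sets [measurable]: "F A \<in> sets (M n)" if A: "A \<in> As" for A
  proof -
    have "finite A" using A finite_subset by (auto simp: As_def)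
    have "Measurable.pred (M n) (\<lambda>S. nearest S = A)"
      unfolding nearest_def by (rule measurable_compose[OF nb]) simp
    moreover have "{S \<in> space (M n). dist (fst (S i)) x < r} \<in> sets (M n)" if "i \<in> A" for i
      using D[of i] A that by (intro borel_measurable_less) (auto simp: As_def)
    then have "{S \<in> space (M n). \<forall>i\<in>A. dist (fst (S i)) x < r} \<in> sets (M n)"
      by (rule sets.sets_Collect_finite_All) (use \<open>finite A\<close> in simp_all)
    ultimately have "{S \<in> space (M n). nearest S = A} \<inter> {S \<in> space (M n). \<forall>i\<in>A. dist (fst (S i)) x < r} \<in> sets (M n)"
      unfolding pred_def by (rule sets.Int)
    also have "{S \<in> space (M n). nearest S = A} \<inter> {S \<in> space (M n). \<forall>i\<in>A. dist (fst (S i)) x < r} = F A"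
      by (auto simp: F_def C_def dist_commute)
    finally show ?thesis .
  qed
  have E_sets [measurable]: "E A \<in> sets (M n)" if A: "A \<in> As" for A
  proof -
    have [measurable]: "(\<lambda>S. dev S A) \<in> borel_measurable (M n)"
      unfolding dev_def
    proof (rule borel_measurable_sum)
      fix i assume "i \<in> A"
      then have "i < n" using A by (auto simp: As_def)
      show "(\<lambda>S. \<sigma> * (of_bool (snd (S i)) - 1/2)) \<in> borel_measurable (M n)"
        by (rule measurable_compose[OF Y[OF \<open>i < n\<close>]]) simp
    qed
    have "E A = F A \<inter> {S \<in> space (M n). dev S A \<le> m * s - sqrt m * t}"
      by (auto simp: E_def F_def)
    then show ?thesis
      using F_sets[OF A] by simp
  qed
  have E_le: "emeasure (M n) (E A) \<le> ennreal (exp (- 2 * t\<^sup>2)) * emeasure (M n) (F A)" if A: "A \<in> As" for A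
  proof -
    let ?c = "exp (\<theta>\<^sup>2 / 8 - \<theta> * s)" and ?K = "exp (\<theta> * (m * s - sqrt m * t))"
    have finA: "finite A" using A finite_subset by (auto simp: As_def)
    have "emeasure (M n) (E A) = (\<integral>\<^sup>+S. indicator (E A) S \<partial>M n)"
      using E_sets[OF A] by simp
    also have "\<dots> \<le> (\<integral>\<^sup>+S. ennreal ?K * (indicator (F A) S * (\<Prod>i\<in>A. ennreal (g (snd (S i))))) \<partial>M n)"
    proof (rule nn_integral_mono)
      fix S
      have "1 \<le> ?K * (\<Prod>i\<in>A. g (snd (S i)))" if "S \<in> E A"
      proof -
        have "\<theta> * dev S A \<le> \<theta> * (m * s - sqrt m * t)"
          using that \<open>\<theta> > 0\<close> by (intro mult_left_mono) (auto simp: E_def)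
        moreover have "(\<Prod>i\<in>A. g (snd (S i))) = exp (- \<theta> * dev S A)"
          unfolding g_def dev_def sum_distrib_left by (simp add: exp_sum[OF finA])
        ultimately show ?thesis
          by (simp add: exp_add[symmetric])
      qed
      then show "indicator (E A) S \<le> ennreal ?K * (indicator (F A) S * (\<Prod>i\<in>A. ennreal (g (snd (S i)))))"
        by (auto simp: indicator_def E_def prod_ennreal g_def ennreal_mult[symmetric] prod_nonneg)
    qed
    also have "\<dots> = ennreal ?K * (\<integral>\<^sup>+S. indicator (F A) S * (\<Prod>i\<in>A. ennreal (g (snd (S i)))) \<partial>M n)"
    proof (rule nn_integral_cmult)
      have "(\<lambda>S. ennreal (g (snd (S i)))) \<in> borel_measurable (M n)" if "i \<in> A" for i
        by (rule measurable_compose[OF Y]) (use that A in \<open>auto simp: As_def\<close>)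
      then show "(\<lambda>S. indicator (F A) S * (\<Prod>i\<in>A. ennreal (g (snd (S i))))) \<in> borel_measurable (M n)"
        using F_sets[OF A] by (intro borel_measurable_times_ennreal borel_measurable_prod_ennreal) auto
    qed
    also have "\<dots> \<le> ennreal ?K * (ennreal ?c ^ card A * (\<integral>\<^sup>+S. indicator (F A) S \<partial>M n))"
    proof (intro mult_left_mono)
      have "AE y in marginal P. y \<in> ball x r \<longrightarrow> \<eta> y * g True + (1 - \<eta> y) * g False \<le> ?c"
        using signal
      proof eventually_elim
        case (elim y)
        then show ?case
          unfolding g_def using \<sigma> \<open>\<theta> > 0\<close> regression_ge_0[OF cube reg] regression_le_1[OF cube reg]
          by (intro impI signed_label_mgf) auto
      qed
      have "(\<integral>\<^sup>+S. indicator (F A) S * (\<Prod>i\<in>A. ennreal (g (snd (S i)))) \<partial>(\<Pi>\<^sub>M i\<in>{..<n}. P))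
          \<le> ennreal ?c ^ card A * (\<integral>\<^sup>+S. indicator (F A) S \<partial>(\<Pi>\<^sub>M i\<in>{..<n}. P))"
      proof -
        have "(\<integral>\<^sup>+S. indicator (F A) S * (\<Prod>i\<in>A. ennreal (g (snd (S i)))) \<partial>(\<Pi>\<^sub>M i\<in>{..<n}. P))
            = (\<integral>\<^sup>+S. indicator (C A) S * (\<Prod>i\<in>A. ennreal (g (snd (S i)))) \<partial>(\<Pi>\<^sub>M i\<in>{..<n}. P))"
          by (intro nn_integral_cong) (simp add: F_def indicator_def M_def)
        also have "\<dots> \<le> ennreal ?c ^ card A * (\<integral>\<^sup>+S. indicator (C A) S \<partial>(\<Pi>\<^sub>M i\<in>{..<n}. P))"
        proof (rule label_mgf[OF cube reg, where B = "ball x r"])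
          have "(indicator (F A) :: _ \<Rightarrow> ennreal) \<in> borel_measurable (M n)"
            using F_sets[OF A] by simp
          moreover have "(indicator (C A) :: _ \<Rightarrow> ennreal) \<in> borel_measurable (M n)
              \<longleftrightarrow> (indicator (F A) :: _ \<Rightarrow> ennreal) \<in> borel_measurable (M n)"
            by (rule measurable_cong) (simp add: F_def indicator_def)
          ultimately show "(indicator (C A) :: _ \<Rightarrow> ennreal) \<in> borel_measurable (\<Pi>\<^sub>M i\<in>{..<n}. P)"
            by (simp add: M_def)
          show "indicator (C A) S = (indicator (C A) S' :: ennreal)"
            if "\<And>i. fst (S i) = fst (S' i)" for S S'
            using that by (simp add: C_def nearest_def neighbours_def indicator_def)
          show "AE y in marginal P. y \<in> ball x r \<longrightarrow> \<eta> y * g True + (1 - \<eta> y) * g False \<le> ?c"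
            by fact
        qed (use A in \<open>auto simp: As_def C_def g_def indicator_def split: if_splits\<close>)
        also have "(\<integral>\<^sup>+S. indicator (C A) S \<partial>(\<Pi>\<^sub>M i\<in>{..<n}. P))
            = (\<integral>\<^sup>+S. indicator (F A) S \<partial>(\<Pi>\<^sub>M i\<in>{..<n}. P))"
          by (intro nn_integral_cong) (simp add: F_def indicator_def M_def)
        finally show ?thesis .
      qed
      then show "(\<integral>\<^sup>+S. indicator (F A) S * (\<Prod>i\<in>A. ennreal (g (snd (S i)))) \<partial>M n)
          \<le> ennreal ?c ^ card A * (\<integral>\<^sup>+S. indicator (F A) S \<partial>M n)"
        by (simp add: M_def)
    qed simp
    also have "\<dots> = ennreal (?K * ?c ^ m) * emeasure (M n) (F A)"
      using A F_sets[OF A] by (simp add: As_def ennreal_mult ennreal_power mult_ac)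
    also have "?K * ?c ^ m = exp (m * (\<theta>\<^sup>2 / 8) - \<theta> * (sqrt m * t))"
      by (simp add: exp_of_nat_mult[symmetric] exp_add[symmetric] algebra_simps)
    also have "m * (\<theta>\<^sup>2 / 8) - \<theta> * (sqrt m * t) = - 2 * t\<^sup>2"
      using m by (simp add: \<theta>_def power_divide power_mult_distrib power2_eq_square)
    finally show ?thesis .
  qed
  show ?thesis
  proof (intro bexI conjI)
    show "(\<Union>A\<in>As. E A) \<in> sets (M n)"
      using E_sets \<open>finite As\<close> by blast
    have "emeasure (M n) (\<Union>A\<in>As. E A) \<le> (\<Sum>A\<in>As. emeasure (M n) (E A))"
      using E_sets \<open>finite As\<close> by (intro emeasure_subadditive_finite) auto
    also have "\<dots> \<le> ennreal (exp (- 2 * t\<^sup>2)) * (\<Sum>A\<in>As. emeasure (M n) (F A))"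
      unfolding sum_distrib_left by (intro sum_mono E_le)
    also have "(\<Sum>A\<in>As. emeasure (M n) (F A)) = emeasure (M n) (\<Union>A\<in>As. F A)"
      using F_sets \<open>finite As\<close> by (intro sum_emeasure) (auto simp: disjoint_family_on_def F_def C_def)
    also have "ennreal (exp (- 2 * t\<^sup>2)) * emeasure (M n) (\<Union>A\<in>As. F A) \<le> ennreal (exp (- 2 * t\<^sup>2)) * 1"
      by (intro mult_left_mono PM.measure_le_1 PM.emeasure_le_1) auto
    finally show "emeasure (M n) (\<Union>A\<in>As. E A) \<le> ennreal (exp (- 2 * t\<^sup>2))"
      by simp
    show "{S \<in> space (M n). m \<le> ball_count n S x r \<and>
        \<sigma> * (sqrt (real m) * (knn_estimate n S x m - 1/2)) < sqrt (real m) * s - t} \<subseteq> (\<Union>A\<in>As. E A)"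
    proof safe
      fix S assume S: "S \<in> space (M n)" and count: "m \<le> ball_count n S x r"
        and low: "\<sigma> * (sqrt (real m) * (knn_estimate n S x m - 1/2)) < sqrt (real m) * s - t"
      have "ball_count n S x r \<le> n"
        unfolding ball_count_def by (metis length_filter_le length_upt minus_nat.diff_0)
      then have "m \<le> n" using count by simp
      have len: "length (neighbours n S x) = n" and dis: "distinct (neighbours n S x)"
        and set: "set (neighbours n S x) = {..<n}"
        by (auto simp: neighbours_def)
      have near: "nearest S = (\<lambda>j. neighbours n S x ! j) ` {..<m}"
        using \<open>m \<le> n\<close> len by (simp add: nearest_def nth_image[symmetric] lessThan_atLeast0)
      have inj: "inj_on (\<lambda>j. neighbours n S x ! j) {..<m}"
        using dis len \<open>m \<le> n\<close> by (auto simp: inj_on_def nth_eq_iff_index_eq)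
      have "nearest S \<in> As"
        using near inj set set_take_subset[of m "neighbours n S x"]
        by (auto simp: As_def card_image nearest_def)
      have "dev S (nearest S) = (\<Sum>j<m. \<sigma> * (of_bool (snd (S (neighbours n S x ! j))) - 1/2))"
        unfolding dev_def near by (simp add: sum.reindex[OF inj] o_def)
      also have "\<dots> = \<sigma> * (m * (knn_estimate n S x m - 1/2))"
      proof -
        have "real m * (knn_estimate n S x m - 1/2)
            = (\<Sum>j<m. of_bool (snd (S (neighbours n S x ! j))) - 1/2)"
          using m unfolding knn_estimate_def sum_subtractf
          by (simp add: right_diff_distrib del: sum_of_bool_eq)
        then show ?thesis
          by (simp only: sum_distrib_left[symmetric])
      qed
      also have "\<dots> = (sqrt m * sqrt m) * (\<sigma> * (knn_estimate n S x m - 1/2))"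
        by simp
      also have "\<dots> = sqrt m * (\<sigma> * (sqrt m * (knn_estimate n S x m - 1/2)))"
        by (simp only: mult_ac)
      also have "\<dots> \<le> sqrt m * (sqrt m * s - t)"
        using low by (intro mult_left_mono) auto
      also have "\<dots> = (sqrt m * sqrt m) * s - sqrt m * t"
        by (simp only: right_diff_distrib mult.assoc)
      also have "\<dots> = m * s - sqrt m * t"
        by simp
      finally have "S \<in> E (nearest S)"
        using S neighbours_in_ball[of _ n S x r] count near
        by (auto simp: E_def F_def C_def dist_commute)
      then show "S \<in> (\<Union>A\<in>As. E A)"
        using \<open>nearest S \<in> As\<close> by blast
    qed
  qed
qed

section \<open>Error probability at a point\<close>

lemma ball_count_le: "ball_count n S x r \<le> n"
  unfolding ball_count_def by (metis length_filter_le length_upt minus_nat.diff_0)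

text \<open>Chernoff's bound for the lower tail of a binomial variable, with exponential parameter \<open>1\<close> and
  the estimate \<open>exp (- 1) \<le> 2/5\<close>: the exponent is \<open>n * q * (1/2 - 3/5)\<close>.\<close>

lemma ball_count_lower_tail:
  fixes P :: "('d::finite) law" and x :: "'d point"
  assumes cube: "cube_law P" and q: "0 \<le> q" "q \<le> measure (marginal P) (ball x r)"
  shows "\<exists>E\<in>sets (\<Pi>\<^sub>M i\<in>{..<n}. P). emeasure (\<Pi>\<^sub>M i\<in>{..<n}. P) E \<le> ennreal (exp (- real n * q / 10)) \<and>
    {S \<in> space (\<Pi>\<^sub>M i\<in>{..<n}. P). real (ball_count n S x r) < real n * q / 2} \<subseteq> E"
proof -
  interpret P: prob_space P using cube by (simp add: cube_law_def)
  interpret product_sigma_finite "\<lambda>_::nat. P" by standard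
  define M where "M = (\<Pi>\<^sub>M i\<in>{..<n}. P)"
  define p where "p = measure (marginal P) (ball x r)"
  define B where "B = {z :: 'd point \<times> bool. dist (fst z) x < r}"
  define E where "E = {S \<in> space M. (\<Sum>i<n. indicator B (S i)) \<le> real n * q / 2}"
  have fst_P: "fst \<in> P \<rightarrow>\<^sub>M borel"
    by (simp add: measurable_cong_sets[OF cube_law_sets[OF cube] refl])
  have B_eq: "fst -` ball x r \<inter> space P = B"
    by (auto simp: B_def cube_law_space[OF cube] dist_commute)
  have B: "B \<in> sets P"
    unfolding B_eq[symmetric] by (rule measurable_sets[OF fst_P]) simp
  have p: "measure P B = p"
  proof -
    have "p = measure P (fst -` ball x r \<inter> space P)"
      unfolding p_def marginal_def by (rule measure_distr[OF fst_P]) simp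
    then show ?thesis
      by (simp add: B_eq)
  qed
  have p01: "0 \<le> p" "p \<le> 1"
    using P.prob_le_1[of B] p by auto
  have Bi: "(\<lambda>S. indicator B (S i) :: real) \<in> borel_measurable M" if "i < n" for i
    unfolding M_def using that B
    by (intro measurable_compose[OF measurable_component_singleton]) auto
  have E: "E \<in> sets M"
    unfolding E_def by (intro borel_measurable_le borel_measurable_sum Bi) auto
  let ?h = "\<lambda>z. ennreal (exp (- indicator B z))"
  have h: "(\<integral>\<^sup>+z. ?h z \<partial>P) \<le> ennreal (exp (- (3/5) * q))"
  proof -
    have "(\<integral>\<^sup>+z. ?h z \<partial>P) = (\<integral>\<^sup>+z. ennreal (exp (-1)) * indicator B z + indicator (space P - B) z \<partial>P)"
      by (intro nn_integral_cong) (auto simp: indicator_def)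
    also have "\<dots> = ennreal (exp (-1)) * emeasure P B + emeasure P (space P - B)"
      using B by (subst nn_integral_add) (auto simp: nn_integral_cmult)
    also have "\<dots> = ennreal (exp (-1) * p + (1 - p))"
      using B p01 by (simp add: P.emeasure_eq_measure P.prob_compl p ennreal_mult)
    also have "\<dots> \<le> ennreal (exp (- (3/5) * q))"
    proof (rule ennreal_leI)
      have "exp (1::real) \<ge> 5/2"
        using exp_lower_Taylor_quadratic[of 1] by simp
      then have "exp (-1::real) \<le> 2/5"
        by (simp add: exp_minus field_simps)
      then have "exp (-1) * p \<le> 2/5 * p"
        using p01 by (intro mult_right_mono) auto
      then have "exp (-1) * p + (1 - p) \<le> 1 + (- (3/5) * q)"
        using q p_def by simp
      also have "\<dots> \<le> exp (- (3/5) * q)"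
        by (rule exp_ge_add_one_self)
      finally show "exp (-1) * p + (1 - p) \<le> exp (- (3/5) * q)" .
    qed
    finally show ?thesis .
  qed
  have "emeasure M E = (\<integral>\<^sup>+S. indicator E S \<partial>M)"
    using E by simp
  also have "\<dots> \<le> (\<integral>\<^sup>+S. ennreal (exp (real n * q / 2)) * (\<Prod>i<n. ?h (S i)) \<partial>M)"
  proof (rule nn_integral_mono)
    fix S
    have "1 \<le> exp (real n * q / 2) * (\<Prod>i<n. exp (- indicator B (S i)))" if "S \<in> E"
      using that unfolding E_def
      by (simp add: exp_sum[symmetric] sum_negf exp_add[symmetric])
    then show "indicator E S \<le> ennreal (exp (real n * q / 2)) * (\<Prod>i<n. ?h (S i))"
      by (auto simp: indicator_def[of E] prod_ennreal ennreal_mult[symmetric] prod_nonneg)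
  qed
  also have "\<dots> = ennreal (exp (real n * q / 2)) * (\<integral>\<^sup>+S. (\<Prod>i<n. ?h (S i)) \<partial>M)"
  proof (rule nn_integral_cmult)
    have "(\<lambda>S. ?h (S i)) \<in> borel_measurable M" if "i < n" for i
      using Bi[OF that] by measurable
    then show "(\<lambda>S. \<Prod>i<n. ?h (S i)) \<in> borel_measurable M"
      by (intro borel_measurable_prod_ennreal) auto
  qed
  also have "(\<integral>\<^sup>+S. (\<Prod>i<n. ?h (S i)) \<partial>M) = (\<Prod>i<n. \<integral>\<^sup>+z. ?h z \<partial>P)"
    unfolding M_def using B by (intro product_nn_integral_prod) auto
  also have "\<dots> \<le> ennreal (exp (- (3/5) * q)) ^ n"
    using h by (simp add: power_mono)
  also have "ennreal (exp (real n * q / 2)) * ennreal (exp (- (3/5) * q)) ^ n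
      = ennreal (exp (- real n * q / 10))"
    by (simp add: ennreal_power ennreal_mult[symmetric] exp_of_nat_mult[symmetric] exp_add[symmetric]
        algebra_simps)
  finally have "emeasure M E \<le> ennreal (exp (- real n * q / 10))"
    by (simp add: mult_left_mono)
  moreover have "real (ball_count n S x r) = (\<Sum>i<n. indicator B (S i))" for S
  proof -
    have "ball_count n S x r = card ({..<n} \<inter> {i. S i \<in> B})"
      unfolding ball_count_def length_filter_conv_card
      by (auto intro!: arg_cong[where f = card] simp: B_def)
    also have "real \<dots> = (\<Sum>i<n. indicator B (S i))"
      by (simp add: indicator_def)
    finally show ?thesis .
  qed
  ultimately show ?thesis
    using E unfolding M_def[symmetric] by (intro bexI[of _ E]) (auto simp: E_def)
qed

lemma sample_concentrated:
  fixes P :: "('d::finite) law" and x :: "'d point"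
  assumes cube: "cube_law P" and reg: "regression_function P \<eta>"
    and \<sigma>: "\<sigma> = 1 \<or> \<sigma> = -1" and t: "t > 0"
    and signal: "AE y in marginal P. y \<in> ball x r \<longrightarrow> \<sigma> * (\<eta> y - 1/2) \<ge> s"
  shows "\<exists>E\<in>sets (\<Pi>\<^sub>M i\<in>{..<n}. P). emeasure (\<Pi>\<^sub>M i\<in>{..<n}. P) E \<le> ennreal (real n * exp (- 2 * t\<^sup>2)) \<and>
    {S \<in> space (\<Pi>\<^sub>M i\<in>{..<n}. P). \<not> concentrated \<sigma> s t n S x (ball_count n S x r)} \<subseteq> E"
proof -
  define M where "M = (\<Pi>\<^sub>M i\<in>{..<n}. P)"
  define bad where "bad m = {S \<in> space M. m \<le> ball_count n S x r \<and>
      \<sigma> * (sqrt (real m) * (knn_estimate n S x m - 1/2)) < sqrt (real m) * s - t}" for m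
  have "\<forall>m\<in>{1..n}. \<exists>E. E \<in> sets M \<and> emeasure M E \<le> ennreal (exp (- 2 * t\<^sup>2)) \<and> bad m \<subseteq> E"
    using nearest_labels_deviation[OF cube reg \<sigma> t _ signal, of _ n]
    unfolding M_def[symmetric] bad_def Bex_def by simp
  from bchoice[OF this] obtain E where E: "\<And>m. m \<in> {1..n} \<Longrightarrow> E m \<in> sets M"
      "\<And>m. m \<in> {1..n} \<Longrightarrow> emeasure M (E m) \<le> ennreal (exp (- 2 * t\<^sup>2))"
      "\<And>m. m \<in> {1..n} \<Longrightarrow> bad m \<subseteq> E m"
    by blast
  have "emeasure M (\<Union>m\<in>{1..n}. E m) \<le> (\<Sum>m\<in>{1..n}. emeasure M (E m))"
    using E(1) by (intro emeasure_subadditive_finite) auto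
  also have "\<dots> \<le> (\<Sum>m\<in>{1..n}. ennreal (exp (- 2 * t\<^sup>2)))"
    by (intro sum_mono E(2))
  also have "\<dots> = ennreal (real n * exp (- 2 * t\<^sup>2))"
    by (simp add: ennreal_of_nat_eq_real_of_nat ennreal_mult)
  finally have "emeasure M (\<Union>m\<in>{1..n}. E m) \<le> ennreal (real n * exp (- 2 * t\<^sup>2))" .
  moreover have "{S \<in> space M. \<not> concentrated \<sigma> s t n S x (ball_count n S x r)} \<subseteq> (\<Union>m\<in>{1..n}. E m)"
  proof
    fix S assume "S \<in> {S \<in> space M. \<not> concentrated \<sigma> s t n S x (ball_count n S x r)}"
    then obtain m where m: "1 \<le> m" "m \<le> ball_count n S x r" "S \<in> space M"
        "\<sigma> * (sqrt (real m) * (knn_estimate n S x m - 1/2)) < sqrt (real m) * s - t"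
      unfolding concentrated_def by auto
    then have "m \<in> {1..n}"
      using ball_count_le[of n S x r] by simp
    then show "S \<in> (\<Union>m\<in>{1..n}. E m)"
      using E(3)[of m] m by (auto simp: bad_def)
  qed
  moreover have "(\<Union>m\<in>{1..n}. E m) \<in> sets M"
    using E(1) by auto
  ultimately show ?thesis
    unfolding M_def by blast
qed

lemma space_data_law:
  fixes P Q :: "('d::finite) law"
  assumes "cube_law P" "cube_law Q"
  shows "sets (data_law nP P nQ Q) = sets (data_space nP nQ)"
    and "space (data_law nP P nQ Q) = space (data_space nP nQ)"
proof -
  show "sets (data_law nP P nQ Q) = sets (data_space nP nQ)"
    unfolding data_law_def data_space_def
    by (intro sets_pair_measure_cong sets_PiM_cong refl cube_law_sets assms)
  then show "space (data_law nP P nQ Q) = space (data_space nP nQ)"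
    by (rule sets_eq_imp_space_eq)
qed

text \<open>If the expected number of points in the ball, weighted with the squared signal, is of the order of
  \<open>t\<^sup>2\<close>, then the ball contains enough points for the stopping rule to fire in it. At least half of the
  expected number of points suffices; since \<open>s \<le> 1/2\<close>, the expected number is large enough for the
  tail bound as well.\<close>

lemma informative_ball:
  fixes P :: "('d::finite) law" and x :: "'d point" and l :: real
  assumes cube: "cube_law P" and q: "0 \<le> q" "q \<le> measure (marginal P) (ball x r)"
    and s: "0 \<le> s" "s \<le> 1/2" and t: "t > 0" "t\<^sup>2 \<ge> l" and large: "real n * q * s\<^sup>2 \<ge> 18 * t\<^sup>2"
  shows "\<exists>E\<in>sets (\<Pi>\<^sub>M i\<in>{..<n}. P). emeasure (\<Pi>\<^sub>M i\<in>{..<n}. P) E \<le> ennreal (exp (- 2 * l)) \<and>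
    {S \<in> space (\<Pi>\<^sub>M i\<in>{..<n}. P). sqrt (real (ball_count n S x r)) * s < 3 * t} \<subseteq> E"
proof -
  have "s\<^sup>2 \<le> (1/2)\<^sup>2"
    using s by (intro power_mono)
  then have "real n * q * s\<^sup>2 \<le> real n * q * (1/2)\<^sup>2"
    using q by (intro mult_left_mono) auto
  then have "real n * q * s\<^sup>2 \<le> real n * q / 4"
    by (simp add: power_divide)
  moreover have "0 \<le> t\<^sup>2" by simp
  ultimately have nq: "real n * q \<ge> 20 * l"
    using large t(2) by linarith
  obtain E where E: "E \<in> sets (\<Pi>\<^sub>M i\<in>{..<n}. P)"
      "emeasure (\<Pi>\<^sub>M i\<in>{..<n}. P) E \<le> ennreal (exp (- real n * q / 10))"
      "{S \<in> space (\<Pi>\<^sub>M i\<in>{..<n}. P). real (ball_count n S x r) < real n * q / 2} \<subseteq> E"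
    using ball_count_lower_tail[OF cube q] by blast
  have "ennreal (exp (- real n * q / 10)) \<le> ennreal (exp (- 2 * l))"
    using nq by (intro ennreal_leI) simp
  moreover have "{S \<in> space (\<Pi>\<^sub>M i\<in>{..<n}. P). sqrt (real (ball_count n S x r)) * s < 3 * t} \<subseteq> E"
  proof safe
    fix S assume S: "S \<in> space (\<Pi>\<^sub>M i\<in>{..<n}. P)" "sqrt (real (ball_count n S x r)) * s < 3 * t"
    have "real (ball_count n S x r) < real n * q / 2"
    proof (rule ccontr)
      assume "\<not> real (ball_count n S x r) < real n * q / 2"
      then have "real n * q / 2 * s\<^sup>2 \<le> real (ball_count n S x r) * s\<^sup>2"
        by (intro mult_right_mono) auto
      then have "(3 * t)\<^sup>2 \<le> real (ball_count n S x r) * s\<^sup>2"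
        using large by (simp add: power_mult_distrib)
      also have "\<dots> = (sqrt (real (ball_count n S x r)) * s)\<^sup>2"
        by (simp add: power_mult_distrib)
      finally have "3 * t \<le> sqrt (real (ball_count n S x r)) * s"
        by (rule power2_le_imp_le) (use s in simp)
      with S show False by simp
    qed
    then show "S \<in> E"
      using E(3) S by blast
  qed
  ultimately show ?thesis
    using E(1,2) by (intro bexI[of _ E]) (auto intro: order_trans)
qed

text \<open>The threshold \<open>(d + 3) * ln n\<close> makes one deviation exceed \<open>t\<close> with probability at most
  \<open>exp (- 2 * t\<^sup>2) = n powr - (d + 3)\<close>, hence at most \<open>n powr - 3\<close>. As \<open>x\<close> is fixed, a union over the
  \<open>nP + nQ\<close> possible neighbour numbers in the two samples is all that is paid.
  It suffices that one of the two samples is informative in the ball; the procedure need not know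
  which one.\<close>

lemma adaptive_error_probability:
  fixes P Q :: "('d::finite) law" and x :: "'d point" and b :: bool
  defines "\<sigma> \<equiv> if b then 1 else - 1 :: real"
    and "L \<equiv> \<lambda>n :: nat. (real CARD('d) + 3) * ln (real n)"
  assumes P: "cube_law P" "regression_function P \<eta>P" and Q: "cube_law Q" "regression_function Q \<eta>Q"
    and f: "adaptive_classifier nP nQ f" and n: "nP + nQ \<ge> 2"
    and sP: "0 \<le> sP" "sP \<le> 1/2" "AE y in marginal P. y \<in> ball x r \<longrightarrow> \<sigma> * (\<eta>P y - 1/2) \<ge> sP"
    and sQ: "0 \<le> sQ" "sQ \<le> 1/2" "AE y in marginal Q. y \<in> ball x r \<longrightarrow> \<sigma> * (\<eta>Q y - 1/2) \<ge> sQ"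
    and q: "0 \<le> q" "q \<le> measure (marginal P) (ball x r)" "q \<le> measure (marginal Q) (ball x r)"
    and large: "real nP * q * sP\<^sup>2 \<ge> 9 * L (nP + nQ) \<or> real nQ * q * sQ\<^sup>2 \<ge> 9 * L (nP + nQ)"
  shows "emeasure (data_law nP P nQ Q) {D \<in> space (data_law nP P nQ Q). f D x \<noteq> b}
    \<le> ennreal (2 / (real (nP + nQ))\<^sup>2)"
proof -
  interpret P: prob_space P using P by (simp add: cube_law_def)
  interpret Q: prob_space Q using Q by (simp add: cube_law_def)
  define n where "n = nP + nQ"
  define MP where "MP = (\<Pi>\<^sub>M i\<in>{..<nP}. P)"
  define MQ where "MQ = (\<Pi>\<^sub>M i\<in>{..<nQ}. Q)"
  interpret MP: prob_space MP unfolding MP_def by (rule prob_space_PiM) (rule P.prob_space_axioms)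
  interpret MQ: prob_space MQ unfolding MQ_def by (rule prob_space_PiM) (rule Q.prob_space_axioms)
  define D where "D = data_law nP P nQ Q"
  have D: "D = MP \<Otimes>\<^sub>M MQ"
    by (simp add: D_def data_law_def MP_def MQ_def)
  have left: "A \<times> space MQ \<in> sets D" "emeasure D (A \<times> space MQ) = emeasure MP A" if "A \<in> sets MP" for A
    using that by (simp_all add: D MQ.emeasure_pair_measure_Times MQ.emeasure_space_1)
  have right: "space MP \<times> A \<in> sets D" "emeasure D (space MP \<times> A) = emeasure MQ A" if "A \<in> sets MQ" for A
    using that by (simp_all add: D MQ.emeasure_pair_measure_Times MP.emeasure_space_1)
  have "ln (real n) > 0"
    using n by (simp add: n_def)
  \<comment> \<open>twice the squared fluctuation is the threshold of the stopping rule\<close>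
  define t where "t = sqrt (L n / 2)"
  have t: "t > 0" and t2: "2 * t\<^sup>2 = L n"
    using \<open>ln (real n) > 0\<close> by (simp_all add: t_def L_def)
  have tl: "t\<^sup>2 \<ge> ln (real n)"
  proof -
    have "2 * ln (real n) \<le> L n"
      unfolding L_def using \<open>ln (real n) > 0\<close> by (intro mult_right_mono) auto
    then show ?thesis using t2 by linarith
  qed
  have \<sigma>: "\<sigma> = 1 \<or> \<sigma> = -1" by (simp add: \<sigma>_def)
  have npos: "real n > 0" using n by (simp add: n_def)
  have "real 3 * ln (real n) \<le> L n"
    unfolding L_def using \<open>ln (real n) > 0\<close> by (intro mult_right_mono) auto
  then have "exp (- 2 * t\<^sup>2) \<le> exp (- (real 3 * ln (real n)))"
    using t2 by simp
  also have "\<dots> = 1 / real n ^ 3"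
    using npos by (simp only: exp_minus exp_of_nat_mult exp_ln) (simp add: field_simps)
  finally have tail: "exp (- 2 * t\<^sup>2) \<le> 1 / real n ^ 3" .
  have sq: "exp (- 2 * ln (real n)) = 1 / (real n)\<^sup>2"
    using npos exp_of_nat_mult[of 2 "ln (real n)"] by (simp add: exp_minus field_simps)
  obtain EP where EP: "EP \<in> sets MP" "emeasure MP EP \<le> ennreal (real nP * exp (- 2 * t\<^sup>2))"
      "{S \<in> space MP. \<not> concentrated \<sigma> sP t nP S x (ball_count nP S x r)} \<subseteq> EP"
    using sample_concentrated[OF P \<sigma> t sP(3), of nP, folded MP_def] by blast
  obtain EQ where EQ: "EQ \<in> sets MQ" "emeasure MQ EQ \<le> ennreal (real nQ * exp (- 2 * t\<^sup>2))"
      "{S \<in> space MQ. \<not> concentrated \<sigma> sQ t nQ S x (ball_count nQ S x r)} \<subseteq> EQ"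
    using sample_concentrated[OF Q \<sigma> t sQ(3), of nQ, folded MQ_def] by blast
  obtain E where E: "E \<in> sets D" "emeasure D E \<le> ennreal (1 / (real n)\<^sup>2)"
      "{d \<in> space D. sqrt (real (ball_count nP (fst d) x r)) * sP < 3 * t \<and>
          sqrt (real (ball_count nQ (snd d) x r)) * sQ < 3 * t} \<subseteq> E"
  proof (cases "real nP * q * sP\<^sup>2 \<ge> 9 * L n")
    case True
    then have "real nP * q * sP\<^sup>2 \<ge> 18 * t\<^sup>2" using t2 by simp
    then obtain E where "E \<in> sets MP" "emeasure MP E \<le> ennreal (1 / (real n)\<^sup>2)"
        "{S \<in> space MP. sqrt (real (ball_count nP S x r)) * sP < 3 * t} \<subseteq> E"
      using informative_ball[OF P(1) q(1,2) sP(1,2) t tl, of nP, folded MP_def, unfolded sq] by blast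
    then show ?thesis
      using left[of E] by (intro that[of "E \<times> space MQ"]) (auto simp: D space_pair_measure sq)
  next
    case False
    then have "real nQ * q * sQ\<^sup>2 \<ge> 18 * t\<^sup>2" using t2 large by (simp add: n_def)
    then obtain E where "E \<in> sets MQ" "emeasure MQ E \<le> ennreal (1 / (real n)\<^sup>2)"
        "{S \<in> space MQ. sqrt (real (ball_count nQ S x r)) * sQ < 3 * t} \<subseteq> E"
      using informative_ball[OF Q(1) q(1,3) sQ(1,2) t tl, of nQ, folded MQ_def, unfolded sq] by blast
    then show ?thesis
      using right[of E] by (intro that[of "space MP \<times> E"]) (auto simp: D space_pair_measure sq)
  qed
  define Bad where "Bad = (EP \<times> space MQ \<union> space MP \<times> EQ) \<union> E"
  have "{d \<in> space D. f d x \<noteq> b} \<subseteq> Bad"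
  proof (rule subsetI)
    fix d assume "d \<in> {d \<in> space D. f d x \<noteq> b}"
    then have d: "d \<in> space D" and wrong: "f d x \<noteq> b"
      by auto
    show "d \<in> Bad"
    proof (rule ccontr)
      assume "d \<notin> Bad"
      then have good: "concentrated \<sigma> sP t nP (fst d) x (ball_count nP (fst d) x r)"
          "concentrated \<sigma> sQ t nQ (snd d) x (ball_count nQ (snd d) x r)"
          "sqrt (real (ball_count nP (fst d) x r)) * sP \<ge> 3 * t \<or> sqrt (real (ball_count nQ (snd d) x r)) * sQ \<ge> 3 * t"
        using d EP(3) EQ(3) E(3) by (auto simp: Bad_def D space_pair_measure not_less)
      have "d \<in> space (data_space nP nQ)"
        using d space_data_law(2)[OF P(1) Q(1), of nP nQ] by (simp add: D_def)
      then obtain k where k: "is_k_star nP nQ d x k" "f d x = intermediate_classifier nP nQ d k x"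
        using f unfolding adaptive_classifier_def by blast
      have "2 * t\<^sup>2 = (real CARD('d) + 3) * ln (real (nP + nQ))"
        using t2 by (simp add: L_def n_def)
      from adaptive_choice_correct[OF \<sigma> t this sP(1) sQ(1) good k(1)]
      show False
        using wrong unfolding k(2) intermediate_classifier_def \<sigma>_def by (auto split: if_splits)
    qed
  qed
  moreover have "Bad \<in> sets D"
    unfolding Bad_def using left(1)[OF EP(1)] right(1)[OF EQ(1)] E(1) by auto
  ultimately have "emeasure D {d \<in> space D. f d x \<noteq> b} \<le> emeasure D Bad"
    by (rule emeasure_mono)
  also have "\<dots> \<le> (emeasure D (EP \<times> space MQ) + emeasure D (space MP \<times> EQ)) + emeasure D E"
    unfolding Bad_def using left(1)[OF EP(1)] right(1)[OF EQ(1)] E(1)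
    by (intro order_trans[OF emeasure_subadditive] add_mono emeasure_subadditive order_refl) auto
  also have "\<dots> \<le> (ennreal (real nP * exp (- 2 * t\<^sup>2)) + ennreal (real nQ * exp (- 2 * t\<^sup>2))) + ennreal (1 / (real n)\<^sup>2)"
    using left(2)[OF EP(1)] right(2)[OF EQ(1)] EP(2) EQ(2) E(2) by (intro add_mono) auto
  also have "\<dots> = ennreal (real n * exp (- 2 * t\<^sup>2) + 1 / (real n)\<^sup>2)"
    by (simp add: ennreal_plus[symmetric] n_def algebra_simps del: ennreal_plus)
  also have "\<dots> \<le> ennreal (2 / (real n)\<^sup>2)"
  proof (rule ennreal_leI)
    have "real n * exp (- 2 * t\<^sup>2) \<le> real n * (1 / real n ^ 3)"
      using tail by (intro mult_left_mono) auto
    also have "\<dots> = 1 / (real n)\<^sup>2"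
      using npos by (simp add: power2_eq_square power3_eq_cube)
    finally show "real n * exp (- 2 * t\<^sup>2) + 1 / (real n)\<^sup>2 \<le> 2 / (real n)\<^sup>2"
      by simp
  qed
  finally show ?thesis
    by (simp add: D_def n_def)
qed

section \<open>From error probabilities to the excess risk\<close>

lemma measurable_bayes_classifier:
  assumes "regression_function Q \<eta>"
  shows "Measurable.pred borel (bayes_classifier \<eta>)"
proof -
  have "\<eta> \<in> borel_measurable borel"
    using assms by (simp add: regression_function_def)
  then show ?thesis
    unfolding bayes_classifier_def[abs_def] by measurable
qed

text \<open>The two possible decisions at \<open>x\<close> err with probabilities \<open>\<eta> x\<close> and \<open>1 - \<eta> x\<close>, and the Bayes
  classifier takes the smaller one, so a decision against it costs their difference.\<close>

lemma excess_risk_integral: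
  fixes Q :: "('d::finite) law"
  assumes cube: "cube_law Q" and reg: "regression_function Q \<eta>" and g: "Measurable.pred borel g"
  shows "0 \<le> excess_risk Q \<eta> g"
    and "ennreal (excess_risk Q \<eta> g)
      = (\<integral>\<^sup>+x. ennreal (2 * \<bar>\<eta> x - 1/2\<bar>) * indicator {x. g x \<noteq> bayes_classifier \<eta> x} x \<partial>marginal Q)"
proof -
  interpret Q: prob_space Q using cube by (simp add: cube_law_def)
  note [measurable] = regression_measurable[OF cube reg] measurable_bayes_classifier[OF reg]
  note le = regression_ge_0[OF cube reg] regression_le_1[OF cube reg]
  have risk: "ennreal (risk Q h) = (\<integral>\<^sup>+x. ennreal (if h x then 1 - \<eta> x else \<eta> x) \<partial>marginal Q)"
    if [measurable]: "Measurable.pred borel h" for h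
  proof -
    have hs [measurable]: "{z. snd z \<noteq> h (fst z)} \<in> sets (pair_space :: 'd law)"
    proof -
      have "{z \<in> space (pair_space :: 'd law). snd z \<noteq> h (fst z)} \<in> sets pair_space"
        by measurable
      then show ?thesis by (simp add: space_pair_measure)
    qed
    have "ennreal (risk Q h) = (\<integral>\<^sup>+z. indicator {z. snd z \<noteq> h (fst z)} z \<partial>Q)"
    proof -
      have "{z. snd z \<noteq> h (fst z)} \<in> sets Q"
        unfolding cube_law_sets[OF cube] by (rule hs)
      then show ?thesis
        by (simp only: risk_def Q.emeasure_eq_measure[symmetric] cube_law_space[OF cube]
            nn_integral_indicator UNIV_I simp_thms)
    qed
    also have "\<dots> = (\<integral>\<^sup>+x. ennreal (if h x then 1 - \<eta> x else \<eta> x) \<partial>marginal Q)"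
      by (subst nn_integral_law[OF cube reg]) (auto intro!: nn_integral_cong)
    finally show ?thesis .
  qed
  let ?X = "\<integral>\<^sup>+x. ennreal (2 * \<bar>\<eta> x - 1/2\<bar>) * indicator {x. g x \<noteq> bayes_classifier \<eta> x} x \<partial>marginal Q"
  have [measurable]: "{x. g x \<noteq> bayes_classifier \<eta> x} \<in> sets borel"
    using g by measurable
  have "ennreal (risk Q g) = (\<integral>\<^sup>+x. ennreal (if bayes_classifier \<eta> x then 1 - \<eta> x else \<eta> x)
      + ennreal (2 * \<bar>\<eta> x - 1/2\<bar>) * indicator {x. g x \<noteq> bayes_classifier \<eta> x} x \<partial>marginal Q)"
    unfolding risk[OF g]
    by (intro nn_integral_cong)
       (auto simp: bayes_classifier_def indicator_def le ennreal_plus[symmetric] abs_if simp del: ennreal_plus)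
  also have "\<dots> = ennreal (risk Q (bayes_classifier \<eta>)) + ?X"
    unfolding risk[OF measurable_bayes_classifier[OF reg]]
    using g by (intro nn_integral_add) (simp_all add: measurable_cong_sets[OF sets_marginal refl])
  finally have eq: "ennreal (risk Q g) = ennreal (risk Q (bayes_classifier \<eta>)) + ?X" .
  have nonneg: "0 \<le> risk Q h" for h
    by (simp add: risk_def)
  have "ennreal (risk Q (bayes_classifier \<eta>)) \<le> ennreal (risk Q g)"
    unfolding eq by simp
  then have le': "risk Q (bayes_classifier \<eta>) \<le> risk Q g"
    using nonneg by simp
  then show "0 \<le> excess_risk Q \<eta> g"
    by (simp add: excess_risk_def)
  have "ennreal (risk Q (bayes_classifier \<eta>)) + ennreal (excess_risk Q \<eta> g)
      = ennreal (risk Q (bayes_classifier \<eta>)) + ?X"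
    unfolding eq[symmetric] excess_risk_def using le' nonneg
    by (simp add: ennreal_plus[symmetric] del: ennreal_plus)
  then show "ennreal (excess_risk Q \<eta> g) = ?X"
    by (simp add: ennreal_add_left_cancel)
qed

text \<open>If \<open>h\<close> is not integrable, its integral is \<open>0\<close> by convention.\<close>

lemma integral_le_of_nn_integral_le:
  fixes h :: "'a \<Rightarrow> real"
  assumes "\<And>x. x \<in> space M \<Longrightarrow> 0 \<le> h x" and "0 \<le> c" and "(\<integral>\<^sup>+x. ennreal (h x) \<partial>M) \<le> ennreal c"
  shows "(LINT x|M. h x) \<le> c"
proof (cases "integrable M h")
  case True
  then have "ennreal (LINT x|M. h x) \<le> ennreal c"
    using assms nn_integral_eq_integral[OF True] by simp
  then show ?thesis using \<open>0 \<le> c\<close> by simp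
next
  case False
  then show ?thesis
    using \<open>0 \<le> c\<close> by (simp add: not_integrable_integral_eq)
qed

lemma prob_space_data_law:
  fixes P Q :: "('d::finite) law"
  assumes "cube_law P" "cube_law Q"
  shows "prob_space (data_law nP P nQ Q)"
proof -
  have "prob_space (\<Pi>\<^sub>M i\<in>{..<nP}. P)" "prob_space (\<Pi>\<^sub>M i\<in>{..<nQ}. Q)"
    using assms by (auto intro!: prob_space_PiM simp: cube_law_def)
  then show ?thesis
    unfolding data_law_def by (intro prob_space_pair)
qed

text \<open>By Fubini's theorem the expected excess risk is an integral over \<open>x\<close> of the error probability at \<open>x\<close>
  times the cost of an error. Closer than \<open>\<Delta>\<close> to the decision boundary the error probability is bounded
  by \<open>1\<close>, the cost by \<open>2 * \<Delta>\<close>, and the mass of these points by the margin condition. Everywhere else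
  the error probability is at most \<open>\<epsilon>\<close>. On the boundary itself an error costs nothing.\<close>

lemma expected_excess_risk_le:
  fixes P Q :: "('d::finite) law"
  assumes P: "cube_law P" and Q: "cube_law Q" "regression_function Q \<eta>"
    and f: "adaptive_classifier nP nQ f"
    and margin: "\<And>t. t > 0 \<Longrightarrow>
      measure (marginal Q) {x. 0 < \<bar>\<eta> x - 1/2\<bar> \<and> \<bar>\<eta> x - 1/2\<bar> < t} \<le> C\<^sub>\<alpha> * t powr \<alpha>"
    and \<Delta>: "\<Delta> > 0" and \<epsilon>: "0 \<le> \<epsilon>" and C\<^sub>\<alpha>: "0 \<le> C\<^sub>\<alpha>"
    and error: "\<And>x. x \<in> support (marginal Q) \<Longrightarrow> \<Delta> \<le> \<bar>\<eta> x - 1/2\<bar> \<Longrightarrow>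
      emeasure (data_law nP P nQ Q) {D \<in> space (data_law nP P nQ Q). f D x \<noteq> bayes_classifier \<eta> x} \<le> ennreal \<epsilon>"
  shows "(LINT D|data_law nP P nQ Q. excess_risk Q \<eta> (f D)) \<le> 2 * C\<^sub>\<alpha> * \<Delta> * \<Delta> powr \<alpha> + \<epsilon>"
proof -
  interpret P: prob_space P using P by (simp add: cube_law_def)
  interpret Q: prob_space Q using Q by (simp add: cube_law_def)
  define M where "M = data_law nP P nQ Q"
  interpret M: prob_space M
    unfolding M_def by (rule prob_space_data_law[OF P Q(1)])
  interpret X: prob_space "marginal Q" by (rule prob_space_marginal[OF Q(1)])
  interpret XM: pair_sigma_finite M "marginal Q" ..
  note sets_M = space_data_law[OF P Q(1), of nP nQ, folded M_def]
  note [measurable] = regression_measurable[OF Q] measurable_bayes_classifier[OF Q(2)]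
  have [measurable_cong]: "sets (marginal Q) = sets borel"
    by (rule sets_marginal)
  have fm: "(\<lambda>(D, x). f D x) \<in> M \<Otimes>\<^sub>M marginal Q \<rightarrow>\<^sub>M count_space UNIV"
    using f unfolding adaptive_classifier_def
    by (simp add: measurable_cong_sets[OF sets_pair_measure_cong[OF sets_M(1) sets_marginal] refl])
  define W where "W = {z \<in> space (M \<Otimes>\<^sub>M marginal Q). f (fst z) (snd z) \<noteq> bayes_classifier \<eta> (snd z)}"
  have W: "W \<in> sets (M \<Otimes>\<^sub>M marginal Q)"
  proof -
    have [measurable]: "Measurable.pred (M \<Otimes>\<^sub>M marginal Q) (\<lambda>z. f (fst z) (snd z))"
      using fm by (simp add: case_prod_beta')
    have [measurable]: "Measurable.pred (M \<Otimes>\<^sub>M marginal Q) (\<lambda>z. bayes_classifier \<eta> (snd z))"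
      by measurable
    show ?thesis
      unfolding W_def by measurable
  qed
  have fD: "Measurable.pred borel (f D)" if "D \<in> space M" for D
  proof -
    have "(\<lambda>x. (\<lambda>(D, x). f D x) (D, x)) \<in> marginal Q \<rightarrow>\<^sub>M count_space UNIV"
      by (rule measurable_compose[OF measurable_Pair1'[OF that] fm])
    then show ?thesis
      by (simp add: measurable_cong_sets[OF sets_marginal refl])
  qed
  define h where "h x = ennreal (2 * \<bar>\<eta> x - 1/2\<bar>)" for x
  have h: "h \<in> borel_measurable (marginal Q)"
    unfolding h_def by measurable
  have "(\<integral>\<^sup>+D. ennreal (excess_risk Q \<eta> (f D)) \<partial>M) = (\<integral>\<^sup>+D. \<integral>\<^sup>+x. h x * indicator W (D, x) \<partial>marginal Q \<partial>M)"
  proof (rule nn_integral_cong)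
    fix D assume D: "D \<in> space M"
    show "ennreal (excess_risk Q \<eta> (f D)) = (\<integral>\<^sup>+x. h x * indicator W (D, x) \<partial>marginal Q)"
      unfolding excess_risk_integral(2)[OF Q fD[OF D]] h_def
      by (intro nn_integral_cong) (auto simp: W_def space_pair_measure D indicator_def)
  qed
  also have "\<dots> = (\<integral>\<^sup>+x. \<integral>\<^sup>+D. h x * indicator W (D, x) \<partial>M \<partial>marginal Q)"
  proof (rule XM.Fubini'[symmetric])
    have "(\<lambda>z. h (snd z) * indicator W z) \<in> borel_measurable (M \<Otimes>\<^sub>M marginal Q)"
      using W h by measurable
    then show "(\<lambda>(D, x). h x * indicator W (D, x)) \<in> borel_measurable (M \<Otimes>\<^sub>M marginal Q)"
      by (simp add: case_prod_beta')
  qed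
  also have "\<dots> \<le> (\<integral>\<^sup>+x. ennreal (2 * \<Delta>) * indicator {x. 0 < \<bar>\<eta> x - 1/2\<bar> \<and> \<bar>\<eta> x - 1/2\<bar> < \<Delta>} x + ennreal \<epsilon> \<partial>marginal Q)"
  proof (rule nn_integral_mono_AE)
    show "AE x in marginal Q. (\<integral>\<^sup>+D. h x * indicator W (D, x) \<partial>M)
        \<le> ennreal (2 * \<Delta>) * indicator {x. 0 < \<bar>\<eta> x - 1/2\<bar> \<and> \<bar>\<eta> x - 1/2\<bar> < \<Delta>} x + ennreal \<epsilon>"
      using AE_in_support[OF sets_marginal]
    proof eventually_elim
      case (elim x)
      have "(\<lambda>D. (D, x)) \<in> M \<rightarrow>\<^sub>M M \<Otimes>\<^sub>M marginal Q"
        by (rule measurable_Pair2') (simp add: marginal_def)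
      from measurable_sets[OF this W] have Wx: "{D \<in> space M. f D x \<noteq> bayes_classifier \<eta> x} \<in> sets M"
        by (rule back_subst[of "\<lambda>A. A \<in> sets M"]) (auto simp: W_def space_pair_measure marginal_def)
      have "(\<integral>\<^sup>+D. h x * indicator W (D, x) \<partial>M)
          = (\<integral>\<^sup>+D. h x * indicator {D \<in> space M. f D x \<noteq> bayes_classifier \<eta> x} D \<partial>M)"
        by (intro nn_integral_cong) (auto simp: W_def space_pair_measure marginal_def indicator_def)
      also have "\<dots> = h x * emeasure M {D \<in> space M. f D x \<noteq> bayes_classifier \<eta> x}"
        using Wx by (rule nn_integral_cmult_indicator)
      finally have eq: "(\<integral>\<^sup>+D. h x * indicator W (D, x) \<partial>M)
          = h x * emeasure M {D \<in> space M. f D x \<noteq> bayes_classifier \<eta> x}" .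
      consider "\<eta> x = 1/2" | "0 < \<bar>\<eta> x - 1/2\<bar>" "\<bar>\<eta> x - 1/2\<bar> < \<Delta>" | "\<Delta> \<le> \<bar>\<eta> x - 1/2\<bar>"
        by force
      then show ?case
      proof cases
        case 1
        have "h x = 0" unfolding h_def 1 by simp
        then show ?thesis unfolding eq by simp
      next
        case 2
        have "h x * emeasure M {D \<in> space M. f D x \<noteq> bayes_classifier \<eta> x} \<le> ennreal (2 * \<Delta>) * 1"
          unfolding h_def using 2 by (intro mult_mono ennreal_leI M.emeasure_le_1) auto
        then show ?thesis
          unfolding eq using 2 by (simp add: add_increasing2)
      next
        case 3
        have "2 * \<bar>\<eta> x - 1/2\<bar> \<le> 1"
          using regression_ge_0[OF Q, of x] regression_le_1[OF Q, of x] by (simp add: abs_if)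
        then have "h x * emeasure M {D \<in> space M. f D x \<noteq> bayes_classifier \<eta> x} \<le> ennreal 1 * ennreal \<epsilon>"
          unfolding h_def M_def using 3 by (intro mult_mono ennreal_leI error elim) auto
        then show ?thesis
          unfolding eq by (simp add: add_increasing)
      qed
    qed
  qed
  also have "\<dots> = ennreal (2 * \<Delta>) * emeasure (marginal Q) {x. 0 < \<bar>\<eta> x - 1/2\<bar> \<and> \<bar>\<eta> x - 1/2\<bar> < \<Delta>} + ennreal \<epsilon>"
    by (subst nn_integral_add)
       (simp_all add: nn_integral_cmult_indicator X.emeasure_space_1 sets_marginal)
  also have "\<dots> \<le> ennreal (2 * \<Delta>) * ennreal (C\<^sub>\<alpha> * \<Delta> powr \<alpha>) + ennreal \<epsilon>"
    using margin[OF \<Delta>] by (intro add_mono mult_left_mono) (auto simp: X.emeasure_eq_measure intro!: ennreal_leI)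
  also have "\<dots> = ennreal (2 * C\<^sub>\<alpha> * \<Delta> * \<Delta> powr \<alpha> + \<epsilon>)"
    using \<Delta> \<epsilon> C\<^sub>\<alpha> by (simp add: ennreal_mult[symmetric] ennreal_plus[symmetric] mult_ac del: ennreal_plus)
  finally have "(\<integral>\<^sup>+D. ennreal (excess_risk Q \<eta> (f D)) \<partial>M) \<le> ennreal (2 * C\<^sub>\<alpha> * \<Delta> * \<Delta> powr \<alpha> + \<epsilon>)" .
  then have "(LINT D|M. excess_risk Q \<eta> (f D)) \<le> 2 * C\<^sub>\<alpha> * \<Delta> * \<Delta> powr \<alpha> + \<epsilon>"
    using \<Delta> \<epsilon> C\<^sub>\<alpha> excess_risk_integral(1)[OF Q fD]
    by (intro integral_le_of_nn_integral_le) auto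
  then show ?thesis
    by (simp add: M_def)
qed

section \<open>Signal and mass of small balls\<close>

text \<open>The density is bounded below on the support only, so the bound for the mass of a ball rests on the
  part of the ball that the support fills.\<close>

lemma ball_mass_ge:
  fixes M :: "('d::finite) point measure"
  assumes dens: "density_between \<mu>\<^sub>1 \<mu>\<^sub>2 M" and "prob_space M" and sets_M: "sets M = sets borel" and \<mu>: "0 < \<mu>\<^sub>1"
    and thick: "c * measure lborel (ball x r) \<le> measure lborel (support M \<inter> ball x r)"
  shows "\<mu>\<^sub>1 * (c * measure lborel (ball x r)) \<le> measure M (ball x r)"
proof -
  interpret M: prob_space M by fact
  obtain p where p [measurable]: "p \<in> borel_measurable borel" and M: "M = density lborel (\<lambda>x. ennreal (p x))"
    and low: "\<And>x. x \<in> support M \<Longrightarrow> \<mu>\<^sub>1 < p x"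
    using dens unfolding density_between_def by blast
  have [measurable]: "support M \<in> sets borel"
    by (rule borel_closed[OF closed_support[OF sets_M]])
  have fin: "emeasure lborel (support M \<inter> ball x r) < \<infinity>"
    using emeasure_bounded_finite[of "support M \<inter> ball x r"] by (simp add: bounded_Int)
  have "ennreal (\<mu>\<^sub>1 * measure lborel (support M \<inter> ball x r)) = ennreal \<mu>\<^sub>1 * emeasure lborel (support M \<inter> ball x r)"
    using \<mu> fin by (simp add: emeasure_eq_ennreal_measure ennreal_mult less_top)
  also have "\<dots> = (\<integral>\<^sup>+y. ennreal \<mu>\<^sub>1 * indicator (support M \<inter> ball x r) y \<partial>lborel)"
    by (simp add: nn_integral_cmult_indicator)
  also have "\<dots> \<le> (\<integral>\<^sup>+y. ennreal (p y) * indicator (ball x r) y \<partial>lborel)"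
    by (intro nn_integral_mono) (auto simp: indicator_def intro!: ennreal_leI less_imp_le[OF low])
  also have "\<dots> = emeasure M (ball x r)"
    using emeasure_density[of "\<lambda>x. ennreal (p x)" lborel "ball x r"] by (simp add: M[symmetric])
  also have "\<dots> = ennreal (measure M (ball x r))"
    by (rule M.emeasure_eq_measure)
  finally have "\<mu>\<^sub>1 * measure lborel (support M \<inter> ball x r) \<le> measure M (ball x r)"
    by simp
  with mult_left_mono[OF thick, of \<mu>\<^sub>1] \<mu> show ?thesis
    by linarith
qed

text \<open>In a ball so small that \<open>\<eta>Q\<close> varies by at most half of its distance \<open>z\<close> to \<open>1/2\<close> at the centre, the class
  does not change and the signal stays at least \<open>z / 2\<close>; the relative signal exponent transfers
  both facts to \<open>\<eta>P\<close>.\<close>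

lemma local_signal:
  fixes P Q :: "('d::finite) law" and x :: "'d point" and \<eta>P \<eta>Q :: "'d point \<Rightarrow> real"
  defines "\<sigma> \<equiv> if bayes_classifier \<eta>Q x then 1 else - 1 :: real" and "z \<equiv> \<bar>\<eta>Q x - 1/2\<bar>"
  assumes signal: "relative_signal_exponent \<gamma> C\<^sub>\<gamma> P \<eta>P Q \<eta>Q"
    and smooth: "smoothness \<beta> C\<^sub>\<beta> Q \<eta>Q" and \<beta>: "0 \<le> \<beta>" and C\<^sub>\<beta>: "0 \<le> C\<^sub>\<beta>" and \<gamma>: "0 < \<gamma>" and C\<^sub>\<gamma>: "0 < C\<^sub>\<gamma>"
    and x: "x \<in> support (marginal Q)" and z: "0 < z"
    and r: "C\<^sub>\<beta> * r powr \<beta> \<le> z / 2"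
    and y: "y \<in> support (marginal Q)" "y \<in> ball x r"
  shows "\<sigma> * (\<eta>Q y - 1/2) \<ge> z / 2" and "\<sigma> * (\<eta>P y - 1/2) \<ge> C\<^sub>\<gamma> * (z / 2) powr \<gamma>"
proof -
  have "\<bar>\<eta>Q x - \<eta>Q y\<bar> \<le> C\<^sub>\<beta> * norm (x - y) powr \<beta>"
    using smooth x y(1) by (simp add: smoothness_def)
  also have "\<dots> \<le> C\<^sub>\<beta> * r powr \<beta>"
    using y(2) \<beta> C\<^sub>\<beta> by (intro mult_left_mono powr_mono2) (auto simp: dist_norm)
  finally have close: "\<bar>\<eta>Q x - \<eta>Q y\<bar> \<le> z / 2"
    using r by simp
  have \<sigma>z: "\<sigma> * (\<eta>Q x - 1/2) = z"
    by (simp add: \<sigma>_def z_def bayes_classifier_def abs_if)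
  have \<sigma>: "\<sigma> = 1 \<or> \<sigma> = -1"
    by (simp add: \<sigma>_def)
  show q: "\<sigma> * (\<eta>Q y - 1/2) \<ge> z / 2"
    using abs_le_D1[OF close] abs_le_D2[OF close] \<sigma>z \<sigma> by (elim disjE) simp_all
  have rel: "(\<eta>P y - 1/2) * (\<eta>Q y - 1/2) \<ge> 0" "\<bar>\<eta>P y - 1/2\<bar> \<ge> C\<^sub>\<gamma> * \<bar>\<eta>Q y - 1/2\<bar> powr \<gamma>"
    using signal y(1) unfolding relative_signal_exponent_def by blast+
  have "C\<^sub>\<gamma> * (z / 2) powr \<gamma> \<le> C\<^sub>\<gamma> * \<bar>\<eta>Q y - 1/2\<bar> powr \<gamma>"
    using q \<sigma> C\<^sub>\<gamma> \<gamma> z by (intro mult_left_mono powr_mono2) auto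
  also have "\<dots> \<le> \<bar>\<eta>P y - 1/2\<bar>" by (rule rel)
  also have "\<dots> = \<sigma> * (\<eta>P y - 1/2)"
  proof -
    have "0 \<le> (\<sigma> * \<sigma>) * ((\<eta>P y - 1/2) * (\<eta>Q y - 1/2))"
      using rel(1) \<sigma> by auto
    also have "\<dots> = (\<sigma> * (\<eta>P y - 1/2)) * (\<sigma> * (\<eta>Q y - 1/2))"
      by (simp only: mult_ac)
    finally have "0 \<le> \<sigma> * (\<eta>P y - 1/2)"
      using q z by (auto simp: zero_le_mult_iff)
    moreover have "\<bar>\<eta>P y - 1/2\<bar> = \<bar>\<sigma> * (\<eta>P y - 1/2)\<bar>"
      using \<sigma> by (auto simp: abs_mult)
    ultimately show ?thesis by simp
  qed
  finally show "\<sigma> * (\<eta>P y - 1/2) \<ge> C\<^sub>\<gamma> * (z / 2) powr \<gamma>" .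
qed

section \<open>The rate\<close>

text \<open>A ball of radius \<open>z powr (1 / \<beta>)\<close> has mass of the order \<open>z powr (d / \<beta>)\<close> and squared signal \<open>z powr (2 * \<gamma>)\<close>
  under \<open>P\<close> and \<open>z powr 2\<close> under \<open>Q\<close>. With \<open>A = nP / ln n\<close> and \<open>B = nQ / ln n\<close> the two products below are
  therefore the information of the samples in the ball, up to constants. The rate
  \<open>S powr (- \<beta> / (2 * \<beta> + d))\<close> is the distance \<open>z\<close> at which one of the two reaches a constant: the larger
  summand of \<open>S\<close> is at least \<open>S / 2\<close>, and solving for \<open>z\<close> in its term gives the same power of \<open>S\<close> in
  both cases.\<close>

lemma signal_above_rate:
  fixes A B z \<beta> \<gamma> d C0 :: real
  defines "a \<equiv> (2 * \<beta> + d) / (2 * \<gamma> * \<beta> + d)"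
  defines "S \<equiv> A powr a + B"
  assumes pos: "0 < \<beta>" "\<beta> \<le> d" "0 < \<gamma>" and AB: "0 \<le> A" "0 \<le> B" and S: "0 < S"
    and C0: "1 \<le> C0" and z: "C0 * S powr (- (\<beta> / (2 * \<beta> + d))) \<le> z"
  shows "A * z powr (2 * \<gamma> + d / \<beta>) \<ge> C0 * (1/2) powr (1 / a) \<or> B * z powr (2 + d / \<beta>) \<ge> C0 / 2"
proof -
  have den: "0 < 2 * \<beta> + d" "0 < 2 * \<gamma> * \<beta> + d"
    using pos by (auto intro!: add_pos_pos)
  have a: "a > 0" using den by (simp add: a_def)
  \<comment> \<open>as \<open>C0 \<ge> 1\<close>, one factor \<open>C0\<close> survives in every power with exponent at least \<open>1\<close>\<close>
  have power: "C0 * S powr (- (\<beta> / (2 * \<beta> + d)) * e) \<le> z powr e" if "e \<ge> 1" for e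
  proof -
    have "C0 powr 1 * (S powr (- (\<beta> / (2 * \<beta> + d)))) powr e \<le> C0 powr e * (S powr (- (\<beta> / (2 * \<beta> + d)))) powr e"
      using C0 that by (intro mult_right_mono powr_mono) auto
    also have "\<dots> = (C0 * S powr (- (\<beta> / (2 * \<beta> + d)))) powr e"
      using C0 by (simp add: powr_mult)
    also have "\<dots> \<le> z powr e"
      using z C0 that by (intro powr_mono2) auto
    finally show ?thesis
      using C0 by (simp add: powr_powr)
  qed
  have d1: "d / \<beta> \<ge> 1" using pos by simp
  show ?thesis
  proof (cases "B \<ge> S / 2")
    case True
    have "2 + d / \<beta> = (2 * \<beta> + d) / \<beta>"
      using pos by (simp add: field_simps)
    then have expo: "- (\<beta> / (2 * \<beta> + d)) * (2 + d / \<beta>) = - 1"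
      using pos den by simp
    have "C0 * S powr (- 1) \<le> z powr (2 + d / \<beta>)"
      using d1 by (intro power[of "2 + d / \<beta>", unfolded expo]) simp
    then have "(S / 2) * (C0 * S powr (- 1)) \<le> B * z powr (2 + d / \<beta>)"
      using True S C0 by (intro mult_mono) auto
    then show ?thesis
      using S by (simp add: powr_minus field_simps)
  next
    case False
    then have "S / 2 \<le> A powr a" by (simp add: S_def)
    then have "(S / 2) powr (1 / a) \<le> (A powr a) powr (1 / a)"
      using S a by (intro powr_mono2) auto
    also have "\<dots> = A"
      using AB a by (simp add: powr_powr)
    finally have Ag: "(1/2) powr (1 / a) * S powr (1 / a) \<le> A"
      using powr_mult[of "1/2" S "1 / a"] S by simp
    have "2 * \<gamma> + d / \<beta> = (2 * \<gamma> * \<beta> + d) / \<beta>"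
      using pos by (simp add: field_simps)
    then have expo: "- (\<beta> / (2 * \<beta> + d)) * (2 * \<gamma> + d / \<beta>) = - (1 / a)"
      using pos den by (simp add: a_def)
    have "C0 * S powr (- (1 / a)) \<le> z powr (2 * \<gamma> + d / \<beta>)"
    proof (rule power[of "2 * \<gamma> + d / \<beta>", unfolded expo])
      show "1 \<le> 2 * \<gamma> + d / \<beta>" using d1 pos by linarith
    qed
    then have "((1/2) powr (1 / a) * S powr (1 / a)) * (C0 * S powr (- (1 / a))) \<le> A * z powr (2 * \<gamma> + d / \<beta>)"
      using Ag C0 AB by (intro mult_mono) auto
    moreover have "S powr (1 / a) * S powr (- (1 / a)) = 1"
      using S by (simp add: powr_add[symmetric])
    then have "((1/2) powr (1 / a) * S powr (1 / a)) * (C0 * S powr (- (1 / a))) = C0 * (1/2) powr (1 / a)"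
      by (metis mult.assoc mult.commute mult.right_neutral)
    ultimately show ?thesis
      by simp
  qed
qed

text \<open>The failure probability \<open>2 / n\<^sup>2\<close> is negligible because \<open>S\<close> grows at most like \<open>n powr ((2 * \<beta> + d) / d)\<close>,
  also for small \<open>\<gamma>\<close>. So the rate decays at most like \<open>n powr (- \<beta> * (1 + \<alpha>) / d)\<close>, and this exponent is at
  most \<open>2\<close> in absolute value by \<open>\<alpha> * \<beta> \<le> d\<close> and \<open>\<beta> \<le> 1 \<le> d\<close>.\<close>

lemma inverse_square_le_rate:
  fixes \<alpha> \<beta> \<gamma> d :: real and nP nQ :: nat
  defines "n \<equiv> real (nP + nQ)"
  defines "S \<equiv> (real nP / ln n) powr ((2 * \<beta> + d) / (2 * \<gamma> * \<beta> + d)) + real nQ / ln n"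
    and "e \<equiv> \<beta> * (1 + \<alpha>) / (2 * \<beta> + d)"
  assumes pos: "0 \<le> \<alpha>" "0 < \<beta>" "\<beta> \<le> 1" "0 < \<gamma>" "1 \<le> d" and \<alpha>\<beta>: "\<alpha> * \<beta> \<le> d" and n: "nP + nQ \<ge> 2"
  shows "2 / n\<^sup>2 \<le> 2 * 2 powr e / (ln 2)\<^sup>2 * S powr (- e)" and "0 < S"
proof -
  define w where "w = n / ln 2"
  define a where "a = (2 * \<beta> + d) / (2 * \<gamma> * \<beta> + d)"
  \<comment> \<open>the value of \<open>a\<close> in the limit \<open>\<gamma> = 0\<close>, its supremum\<close>
  define c where "c = (2 * \<beta> + d) / d"
  have n2: "n \<ge> 2" and ln2: "0 < ln (2::real)" and lnn: "ln 2 \<le> ln n"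
    using n by (auto simp: n_def)
  have lnpos: "0 < ln n"
    using ln2 lnn by linarith
  have ln_lt1: "ln (2::real) \<le> 1"
    using ln_le_minus_one[of "2::real"] by simp
  have w: "w \<ge> 1"
    using n2 ln2 ln_lt1 by (simp add: w_def)
  have \<gamma>\<beta>: "0 < \<gamma> * \<beta>" using pos by simp
  have c1: "1 \<le> c" using pos by (simp add: c_def)
  have ac: "0 < a" "a \<le> c"
    using pos \<gamma>\<beta> by (auto simp: a_def c_def intro!: divide_left_mono divide_pos_pos mult_pos_pos add_pos_pos)
  have le_w: "real m / ln n \<le> w" if "real m \<le> n" for m
    unfolding w_def using that ln2 lnn n2 by (intro frac_le) auto
  have "(real nP / ln n) powr a \<le> w powr a"
  proof (rule powr_mono2)
    show "real nP / ln n \<le> w" by (rule le_w) (simp add: n_def)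
    show "0 \<le> real nP / ln n" using lnpos by simp
  qed (use ac in simp)
  also have "\<dots> \<le> w powr c"
    using ac w by (intro powr_mono) auto
  finally have p: "(real nP / ln n) powr a \<le> w powr c" .
  have "real nQ / ln n \<le> w powr 1"
    using le_w[of nQ] w by (simp add: n_def)
  also have "\<dots> \<le> w powr c"
    using c1 w by (intro powr_mono) auto
  finally have q: "real nQ / ln n \<le> w powr c" .
  have S_le: "S \<le> 2 * w powr c"
    using p q by (simp add: S_def a_def)
  show S: "0 < S"
  proof (cases "nP = 0")
    case True
    then show ?thesis
      using n lnpos by (auto simp: S_def n_def intro!: divide_pos_pos add_nonneg_pos)
  next
    case False
    then show ?thesis
      using lnpos by (auto simp: S_def intro!: add_pos_nonneg divide_nonneg_pos)
  qed
  have e: "0 \<le> e" using pos by (simp add: e_def)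
  have "2 * \<beta> + d \<noteq> 0" using pos by linarith
  then have "c * e = \<beta> * (1 + \<alpha>) / d"
    by (simp add: c_def e_def)
  also have "\<dots> \<le> 2"
    using pos \<alpha>\<beta> by (simp add: field_simps)
  finally have ce: "c * e \<le> 2" .
  have "S powr e \<le> (2 * w powr c) powr e"
    using S S_le e by (intro powr_mono2) auto
  also have "\<dots> = 2 powr e * w powr (c * e)"
    by (simp add: powr_mult powr_powr)
  also have "\<dots> \<le> 2 powr e * w powr 2"
    using ce w by (intro mult_left_mono powr_mono) auto
  also have "w powr 2 = w\<^sup>2"
    using w by simp
  also have "2 powr e * w\<^sup>2 = 2 powr e * n\<^sup>2 / (ln 2)\<^sup>2"
    by (simp add: w_def power_divide)
  finally have Se: "S powr e \<le> 2 powr e * n\<^sup>2 / (ln 2)\<^sup>2" .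
  have "2 / n\<^sup>2 = 2 * 2 powr e / (ln 2)\<^sup>2 * inverse (2 powr e * n\<^sup>2 / (ln 2)\<^sup>2)"
    using ln2 n2 by (simp add: field_simps)
  also have "\<dots> \<le> 2 * 2 powr e / (ln 2)\<^sup>2 * inverse (S powr e)"
    using Se S by (intro mult_left_mono le_imp_inverse_le) auto
  finally show "2 / n\<^sup>2 \<le> 2 * 2 powr e / (ln 2)\<^sup>2 * S powr (- e)"
    by (simp add: powr_minus)
qed

text \<open>At a point whose distance \<open>z\<close> to the decision boundary exceeds the rate by a large constant factor, the
  ball of radius \<open>\<kappa> * z powr (1 / \<beta>)\<close> is small enough for the signal to persist in it, and large enough for
  one of the samples to be informative. The constant \<open>\<kappa>\<close> keeps the variation of \<open>\<eta>Q\<close> below \<open>z / 2\<close> and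
  the radius below \<open>r\<^sub>\<mu>\<close>; the mass of the ball is at least \<open>q0 * z powr (d / \<beta>)\<close>.\<close>

lemma adaptive_error_above_rate:
  fixes P Q :: "('d::finite) law" and x :: "'d point" and nP nQ :: nat
    and \<alpha> C\<^sub>\<alpha> \<beta> C\<^sub>\<beta> \<gamma> C\<^sub>\<gamma> \<mu>\<^sub>1 \<mu>\<^sub>2 c\<^sub>\<mu> r\<^sub>\<mu> C0 :: real
  defines "d \<equiv> real CARD('d)" and "n \<equiv> real (nP + nQ)"
  defines "a \<equiv> (2 * \<beta> + d) / (2 * \<gamma> * \<beta> + d)"
  defines "S \<equiv> (real nP / ln n) powr a + real nQ / ln n"
    and "\<kappa> \<equiv> min ((1 / (2 * C\<^sub>\<beta>)) powr (1 / \<beta>)) r\<^sub>\<mu>"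
  defines "q0 \<equiv> \<mu>\<^sub>1 * (c\<^sub>\<mu> * (unit_ball_vol d * \<kappa> ^ CARD('d)))"
  assumes \<beta>: "0 < \<beta>" "\<beta> \<le> 1" and C\<^sub>\<beta>: "0 < C\<^sub>\<beta>" and \<gamma>: "0 < \<gamma>" "0 < C\<^sub>\<gamma>"
    and \<mu>: "0 < \<mu>\<^sub>1" "0 < c\<^sub>\<mu>" "0 < r\<^sub>\<mu>"
    and PQ: "(P, Q, \<eta>P, \<eta>Q) \<in> parameter_space \<alpha> C\<^sub>\<alpha> \<beta> C\<^sub>\<beta> \<gamma> C\<^sub>\<gamma> \<mu>\<^sub>1 \<mu>\<^sub>2 c\<^sub>\<mu> r\<^sub>\<mu>"
    and f: "adaptive_classifier nP nQ f" and n: "nP + nQ \<ge> 2" and S: "0 < S"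
    and C0: "1 \<le> C0" "72 * (d + 3) \<le> q0 * C0"
      "9 * (d + 3) \<le> q0 * C\<^sub>\<gamma>\<^sup>2 * (1/2) powr (2 * \<gamma>) * (1/2) powr (1 / a) * C0"
    and x: "x \<in> support (marginal Q)" "C0 * S powr (- (\<beta> / (2 * \<beta> + d))) \<le> \<bar>\<eta>Q x - 1/2\<bar>"
  shows "emeasure (data_law nP P nQ Q) {D \<in> space (data_law nP P nQ Q). f D x \<noteq> bayes_classifier \<eta>Q x}
    \<le> ennreal (2 / n\<^sup>2)"
proof -
  define z where "z = \<bar>\<eta>Q x - 1/2\<bar>"
  define r where "r = \<kappa> * z powr (1 / \<beta>)"
  define q where "q = q0 * z powr (d / \<beta>)"
  have cube: "cube_law P" "cube_law Q" and reg: "regression_function P \<eta>P" "regression_function Q \<eta>Q"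
    and signal: "relative_signal_exponent \<gamma> C\<^sub>\<gamma> P \<eta>P Q \<eta>Q" and smooth: "smoothness \<beta> C\<^sub>\<beta> Q \<eta>Q"
    and strong: "strong_density \<mu>\<^sub>1 \<mu>\<^sub>2 c\<^sub>\<mu> r\<^sub>\<mu> P Q"
    using PQ by (simp_all add: parameter_space_def)
  have supp: "support (marginal P) = support (marginal Q)"
    using strong by (simp add: strong_density_def)
  have d: "1 \<le> d" by (simp add: d_def Suc_le_eq)
  have z_pos: "0 < z"
    using x(2) C0(1) S unfolding z_def by (smt (verit) mult_pos_pos powr_gt_zero)
  have z_half: "z \<le> 1/2"
    using regression_ge_0[OF cube(2) reg(2), of x] regression_le_1[OF cube(2) reg(2), of x]
    unfolding z_def by (simp add: abs_if)
  have ln_n: "0 < ln n"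
    using n by (simp add: n_def)
  have \<kappa>: "0 < \<kappa>" using C\<^sub>\<beta> \<mu> by (simp add: \<kappa>_def)
  have q0: "0 < q0" using \<mu> \<kappa> d by (simp add: q0_def)
  have q_nonneg: "0 \<le> q" using q0 by (simp add: q_def)
  have r_pos: "0 < r" using \<kappa> z_pos by (simp add: r_def)
  have "z powr (1 / \<beta>) \<le> 1"
    using powr_mono2[of "1 / \<beta>" z 1] z_pos z_half \<beta> by simp
  then have "\<kappa> * z powr (1 / \<beta>) \<le> \<kappa> * 1"
    using \<kappa> by (intro mult_left_mono) auto
  then have r_le: "r \<le> r\<^sub>\<mu>"
    by (simp add: r_def \<kappa>_def)
  have r_smooth: "C\<^sub>\<beta> * r powr \<beta> \<le> z / 2"
  proof -
    have "\<kappa> powr \<beta> \<le> ((1 / (2 * C\<^sub>\<beta>)) powr (1 / \<beta>)) powr \<beta>"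
      using \<kappa> \<beta> by (intro powr_mono2) (auto simp: \<kappa>_def)
    also have "\<dots> = 1 / (2 * C\<^sub>\<beta>)"
      using \<beta> C\<^sub>\<beta> by (simp add: powr_powr)
    finally have "C\<^sub>\<beta> * \<kappa> powr \<beta> \<le> 1/2"
      using C\<^sub>\<beta> by (simp add: field_simps)
    moreover have "C\<^sub>\<beta> * r powr \<beta> = C\<^sub>\<beta> * \<kappa> powr \<beta> * z"
      using \<beta> \<kappa> z_pos by (simp add: r_def powr_mult powr_powr)
    ultimately show ?thesis
      using mult_right_mono[of "C\<^sub>\<beta> * \<kappa> powr \<beta>" "1/2" z] z_pos by linarith
  qed
  have vol: "\<mu>\<^sub>1 * (c\<^sub>\<mu> * measure lborel (ball x r)) = q"
  proof -
    have "r ^ CARD('d) = \<kappa> ^ CARD('d) * z powr (d / \<beta>)"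
      using z_pos by (simp add: r_def power_mult_distrib powr_power d_def)
    then show ?thesis
      using r_pos by (simp add: content_ball q_def q0_def d_def)
  qed
  have thick: "c\<^sub>\<mu> * measure lborel (ball x r) \<le> measure lborel (support (marginal Q) \<inter> ball x r)"
    using strong x(1) r_pos r_le by (simp add: strong_density_def)
  have mass: "q \<le> measure (marginal P) (ball x r)" "q \<le> measure (marginal Q) (ball x r)"
    using ball_mass_ge[OF _ prob_space_marginal[OF cube(1)] sets_marginal \<mu>(1) thick[folded supp], of \<mu>\<^sub>2]
      ball_mass_ge[OF _ prob_space_marginal[OF cube(2)] sets_marginal \<mu>(1) thick, of \<mu>\<^sub>2]
      strong vol by (simp_all add: strong_density_def)
  let ?\<sigma> = "if bayes_classifier \<eta>Q x then 1 else - 1 :: real"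
  let ?sP = "C\<^sub>\<gamma> * (z / 2) powr \<gamma>" and ?sQ = "z / 2"
  note local = local_signal[OF signal smooth less_imp_le[OF \<beta>(1)] less_imp_le[OF C\<^sub>\<beta>] \<gamma> x(1),
      folded z_def, OF z_pos r_smooth]
  have AE_P: "AE y in marginal P. y \<in> ball x r \<longrightarrow> ?\<sigma> * (\<eta>P y - 1/2) \<ge> ?sP"
    using AE_in_support[OF sets_marginal, of P] by eventually_elim (use local(2) supp in auto)
  have AE_Q: "AE y in marginal Q. y \<in> ball x r \<longrightarrow> ?\<sigma> * (\<eta>Q y - 1/2) \<ge> ?sQ"
    using AE_in_support[OF sets_marginal, of Q] by eventually_elim (use local(1) in auto)
  have sP_half: "?sP \<le> 1/2"
  proof -
    have "?sP \<le> ?\<sigma> * (\<eta>P x - 1/2)"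
      using local(2)[OF x(1)] r_pos by simp
    also have "\<dots> \<le> 1/2"
      using regression_ge_0[OF cube(1) reg(1), of x] regression_le_1[OF cube(1) reg(1), of x] by simp
    finally show ?thesis .
  qed
  have "real nP * q * ?sP\<^sup>2 \<ge> 9 * ((d + 3) * ln n) \<or> real nQ * q * ?sQ\<^sup>2 \<ge> 9 * ((d + 3) * ln n)"
  proof -
    have S': "0 < (real nP / ln n) powr ((2 * \<beta> + d) / (2 * \<gamma> * \<beta> + d)) + real nQ / ln n"
      using S by (simp add: S_def a_def)
    consider
        "C0 * (1/2) powr (1 / a) \<le> real nP / ln n * z powr (2 * \<gamma> + d / \<beta>)"
      | "C0 / 2 \<le> real nQ / ln n * z powr (2 + d / \<beta>)"
      using signal_above_rate[OF \<beta>(1) _ \<gamma>(1) _ _ S' C0(1), of z] x(2) d \<beta> ln_n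
      by (auto simp: z_def S_def a_def)
    then show ?thesis
    proof cases
      case 1
      let ?K = "q0 * C\<^sub>\<gamma>\<^sup>2 * (1/2) powr (2 * \<gamma>)"
      have "((z / 2) powr \<gamma>)\<^sup>2 = (z * (1/2)) powr (2 * \<gamma>)"
        using z_pos by (simp add: powr_power mult.commute)
      also have "\<dots> = z powr (2 * \<gamma>) * (1/2) powr (2 * \<gamma>)"
        using powr_mult[of z "1/2" "2 * \<gamma>"] z_pos by simp
      finally have half: "((z / 2) powr \<gamma>)\<^sup>2 = z powr (2 * \<gamma>) * (1/2) powr (2 * \<gamma>)" .
      have "9 * (d + 3) * ln n \<le> ?K * (1/2) powr (1 / a) * C0 * ln n"
        using C0(3) ln_n by (intro mult_right_mono) auto
      also have "\<dots> = ?K * ln n * (C0 * (1/2) powr (1 / a))"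
        by (simp only: mult_ac)
      also have "\<dots> \<le> ?K * ln n * (real nP / ln n * z powr (2 * \<gamma> + d / \<beta>))"
        using q0 ln_n by (intro mult_left_mono 1) auto
      also have "\<dots> = ?K * (real nP * z powr (2 * \<gamma> + d / \<beta>))"
        using ln_n by simp
      also have "\<dots> = real nP * q * ?sP\<^sup>2"
        unfolding power_mult_distrib half q_def powr_add by (simp only: mult_ac)
      finally show ?thesis by (simp only: mult.assoc simp_thms)
    next
      case 2
      have "9 * (d + 3) * ln n \<le> q0 * C0 / 8 * ln n"
        using C0(2) ln_n by (intro mult_right_mono) auto
      also have "\<dots> = q0 / 4 * ln n * (C0 / 2)"
        by simp
      also have "\<dots> \<le> q0 / 4 * ln n * (real nQ / ln n * z powr (2 + d / \<beta>))"
        using q0 ln_n by (intro mult_left_mono 2) auto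
      also have "\<dots> = q0 / 4 * (real nQ * (z powr 2 * z powr (d / \<beta>)))"
        using ln_n by (simp add: powr_add)
      also have "\<dots> = real nQ * q * ?sQ\<^sup>2"
        using z_pos by (simp add: q_def power_divide)
      finally show ?thesis by (simp only: mult.assoc simp_thms)
    qed
  qed
  then show ?thesis
    unfolding n_def d_def using \<gamma> z_pos z_half sP_half
    by (intro adaptive_error_probability[where sP = ?sP and sQ = ?sQ and q = q and r = r,
        OF cube(1) reg(1) cube(2) reg(2) f n _ _ AE_P _ _ AE_Q q_nonneg mass]) auto
qed

section \<open>The upper bound\<close>

theorem theorem4p1:
  fixes \<alpha> C\<^sub>\<alpha> \<beta> C\<^sub>\<beta> \<gamma> C\<^sub>\<gamma> \<mu>\<^sub>1 \<mu>\<^sub>2 c\<^sub>\<mu> r\<^sub>\<mu> :: real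
  assumes "\<alpha> \<ge> 0" and "C\<^sub>\<alpha> > 0"
    and "0 < \<beta>" and "\<beta> \<le> 1" and "C\<^sub>\<beta> > 0"
    and "\<gamma> > 0" and "C\<^sub>\<gamma> > 0"
    and "0 < \<mu>\<^sub>1" and "\<mu>\<^sub>1 < \<mu>\<^sub>2" and "c\<^sub>\<mu> > 0" and "r\<^sub>\<mu> > 0"
    and "\<alpha> * \<beta> \<le> real CARD('d::finite)"
  shows "\<exists>C>0. \<forall>nP nQ. \<forall>f :: 'd data \<Rightarrow> 'd point \<Rightarrow> bool.
    nP + nQ \<ge> 2 \<and> adaptive_classifier nP nQ f \<longrightarrow>
    (SUP (P, Q, \<eta>P, \<eta>Q) \<in> parameter_space \<alpha> C\<^sub>\<alpha> \<beta> C\<^sub>\<beta> \<gamma> C\<^sub>\<gamma> \<mu>\<^sub>1 \<mu>\<^sub>2 c\<^sub>\<mu> r\<^sub>\<mu>.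
       ereal (LINT D|data_law nP P nQ Q. excess_risk Q \<eta>Q (f D)))
    \<le> ereal (C * ((real nP / ln (real (nP + nQ))) powr
                     ((2 * \<beta> + real CARD('d)) / (2 * \<gamma> * \<beta> + real CARD('d)))
                  + real nQ / ln (real (nP + nQ)))
              powr (- (\<beta> * (1 + \<alpha>) / (2 * \<beta> + real CARD('d)))))"
proof -
  define d where "d = real CARD('d)"
  define a where "a = (2 * \<beta> + d) / (2 * \<gamma> * \<beta> + d)"
  define e where "e = \<beta> * (1 + \<alpha>) / (2 * \<beta> + d)"
  define \<kappa> where "\<kappa> = min ((1 / (2 * C\<^sub>\<beta>)) powr (1 / \<beta>)) r\<^sub>\<mu>"
  define q0 where "q0 = \<mu>\<^sub>1 * (c\<^sub>\<mu> * (unit_ball_vol d * \<kappa> ^ CARD('d)))"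
  define K where "K = q0 * C\<^sub>\<gamma>\<^sup>2 * (1/2) powr (2 * \<gamma>) * (1/2) powr (1 / a)"
  \<comment> \<open>the last two summands of \<open>C0\<close> make the \<open>Q\<close>-sample and the \<open>P\<close>-sample, respectively, informative\<close>
  define C0 where "C0 = 1 + 72 * (d + 3) / q0 + 9 * (d + 3) / K"
  define C where "C = 2 * C\<^sub>\<alpha> * C0 powr (1 + \<alpha>) + 2 * 2 powr e / (ln 2)\<^sup>2"
  have d: "1 \<le> d" by (simp add: d_def Suc_le_eq)
  have q0: "0 < q0"
    using assms d by (simp add: q0_def \<kappa>_def)
  have K: "0 < K"
    using q0 assms by (simp add: K_def)
  have C0: "1 \<le> C0" "72 * (d + 3) \<le> q0 * C0" "9 * (d + 3) \<le> K * C0"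
  proof -
    have terms: "0 < 72 * (d + 3) / q0" "0 < 9 * (d + 3) / K"
      using q0 K d by simp_all
    then show "1 \<le> C0" by (simp add: C0_def)
    have "72 * (d + 3) / q0 \<le> C0" "9 * (d + 3) / K \<le> C0"
      using terms by (simp_all add: C0_def)
    then show "72 * (d + 3) \<le> q0 * C0" "9 * (d + 3) \<le> K * C0"
      using q0 K by (simp_all add: pos_divide_le_eq mult.commute)
  qed
  have "0 < C"
    using C0 assms by (auto simp: C_def intro!: add_pos_pos)
  moreover have "(LINT D|data_law nP P nQ Q. excess_risk Q \<eta>Q (f D))
      \<le> C * ((real nP / ln (real (nP + nQ))) powr a + real nQ / ln (real (nP + nQ))) powr (- e)"
    if n: "nP + nQ \<ge> 2" and f: "adaptive_classifier nP nQ f"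
      and PQ: "(P, Q, \<eta>P, \<eta>Q) \<in> parameter_space \<alpha> C\<^sub>\<alpha> \<beta> C\<^sub>\<beta> \<gamma> C\<^sub>\<gamma> \<mu>\<^sub>1 \<mu>\<^sub>2 c\<^sub>\<mu> r\<^sub>\<mu>"
    for nP nQ and f :: "'d data \<Rightarrow> 'd point \<Rightarrow> bool" and P Q \<eta>P \<eta>Q
  proof -
    define S where "S = (real nP / ln (real (nP + nQ))) powr a + real nQ / ln (real (nP + nQ))"
    define \<Delta> where "\<Delta> = C0 * S powr (- (\<beta> / (2 * \<beta> + d)))"
    note rate = inverse_square_le_rate[OF assms(1,3,4,6) d assms(12)[folded d_def] n,
        folded a_def e_def, folded S_def]
    have \<Delta>: "0 < \<Delta>"
      using C0 rate(2) by (simp add: \<Delta>_def)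
    have cube: "cube_law P" "cube_law Q" and reg: "regression_function Q \<eta>Q"
      and margin: "margin_condition \<alpha> C\<^sub>\<alpha> Q \<eta>Q"
      using PQ by (simp_all add: parameter_space_def)
    have "(LINT D|data_law nP P nQ Q. excess_risk Q \<eta>Q (f D))
        \<le> 2 * C\<^sub>\<alpha> * \<Delta> * \<Delta> powr \<alpha> + 2 / (real (nP + nQ))\<^sup>2"
    proof (rule expected_excess_risk_le[OF cube reg f _ \<Delta>])
      show "measure (marginal Q) {x. 0 < \<bar>\<eta>Q x - 1/2\<bar> \<and> \<bar>\<eta>Q x - 1/2\<bar> < t} \<le> C\<^sub>\<alpha> * t powr \<alpha>"
        if "t > 0" for t
        using margin that by (simp add: margin_condition_def)
      show "emeasure (data_law nP P nQ Q) {D \<in> space (data_law nP P nQ Q). f D x \<noteq> bayes_classifier \<eta>Q x}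
          \<le> ennreal (2 / (real (nP + nQ))\<^sup>2)"
        if "x \<in> support (marginal Q)" "\<Delta> \<le> \<bar>\<eta>Q x - 1/2\<bar>" for x
        by (rule adaptive_error_above_rate[OF assms(3-8,10,11) PQ f n _ C0(1), folded d_def,
              folded a_def \<kappa>_def, folded q0_def, folded S_def K_def, OF rate(2) C0(2,3) that[unfolded \<Delta>_def]])
    qed (use assms in auto)
    also have "2 * C\<^sub>\<alpha> * \<Delta> * \<Delta> powr \<alpha> = 2 * C\<^sub>\<alpha> * C0 powr (1 + \<alpha>) * S powr (- e)"
    proof -
      have "\<Delta> * \<Delta> powr \<alpha> = \<Delta> powr (1 + \<alpha>)"
        using \<Delta> by (simp add: powr_add)
      also have "\<dots> = C0 powr (1 + \<alpha>) * (S powr (- (\<beta> / (2 * \<beta> + d)))) powr (1 + \<alpha>)"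
        unfolding \<Delta>_def using C0 by (simp add: powr_mult)
      also have "(S powr (- (\<beta> / (2 * \<beta> + d)))) powr (1 + \<alpha>) = S powr (- e)"
        by (simp add: powr_powr e_def)
      finally show ?thesis by (simp only: mult.assoc)
    qed
    also have "2 * C\<^sub>\<alpha> * C0 powr (1 + \<alpha>) * S powr (- e) + 2 / (real (nP + nQ))\<^sup>2
        \<le> 2 * C\<^sub>\<alpha> * C0 powr (1 + \<alpha>) * S powr (- e) + 2 * 2 powr e / (ln 2)\<^sup>2 * S powr (- e)"
      by (intro add_left_mono rate(1))
    also have "\<dots> = C * S powr (- e)"
      by (simp only: C_def distrib_right)
    finally show ?thesis
      by (simp only: S_def)
  qed
  ultimately show ?thesis
    unfolding d_def[symmetric] a_def[symmetric] e_def[symmetric]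
    by (intro exI[of _ C] conjI allI impI SUP_least) auto
qed

end
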